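(* Let $\widetilde{H}$ be the affine Hecke algebra of type $G_2$. Let $t=t_{q^2,q^2}$ and $w_0=s_1s_2s_1s_2s_1s_2$. Let $\mathbb{C}v_t$ and $\mathbb{C}v_{w_0t}$ be the $1$-dimensional $\widetilde{H}_{\{1\}}$-modules given by $T_1v_t=qv_t$, $X^\lambda v_t=t(X^\lambda)v_t$, and $T_1v_{w_0t}=-q^{-1}v_{w_0t}$, $X^\lambda v_{w_0t}=(w_0t)(X^\lambda)v_{w_0t}$, and let $M=\widetilde{H}\otimes_{\widetilde{H}_{\{1\}}}\mathbb{C}v_t$ and $N=\widetilde{H}\otimes_{\widetilde{H}_{\{1\}}}\mathbb{C}v_{w_0t}$. If $q^2$ is a primitive fifth root of unity, then (a) $M$ has a $5$-dimensional irreducible submodule $M'$, and (b) $N$ has a $5$-dimensional irreducible submodule $N'$.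
   Context: The type $G_2$ root system has simple roots $\alpha_1,\alpha_2$ with $\langle\alpha_1,\alpha_2^\vee\rangle=-1$, $\langle\alpha_2,\alpha_1^\vee\rangle=-3$; $s_i\lambda=\lambda-\langle\lambda,\alpha_i^\vee\rangle\alpha_i$, and $W_0=\langle s_1,s_2\rangle$. $P=\mathbb{Z}\alpha_1+\mathbb{Z}\alpha_2$ is the weight lattice; $X=\{X^\lambda\mid\lambda\in P\}$, $X^\lambda X^\mu=X^{\lambda+\mu}$. For $q\in\mathbb{C}^\times$, $\widetilde{H}$ is the $\mathbb{C}$-algebra generated by $T_1,T_2$ and $X^\lambda$ ($\lambda\in P$), with the group algebra $\mathbb{C}[X]$ a subalgebra, subject to $T_i^2=(q-q^{-1})T_i+1$, $T_1T_2T_1T_2T_1T_2=T_2T_1T_2T_1T_2T_1$, and $X^\lambda T_i=T_iX^{s_i\lambda}+(q-q^{-1})\frac{X^\lambda-X^{s_i\lambda}}{1-X^{-\alpha_i}}$. $\widetilde{H}_{\{i\}}$ is the subalgebra generated by $T_i$ and $\mathbb{C}[X]$. Weights are elements of $T=\mathrm{Hom}(X,\mathbb{C}^\times)$, with $W_0$-action $(wt)(X^\lambda)=t(X^{w^{-1}\lambda})$; $t_{z,w}\in T$ is given by $t_{z,w}(X^{\alpha_1})=z$, $t_{z,w}(X^{\alpha_2})=w$. *)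

theory Defs
  imports
    Complex_Main
    "HOL-Library.Poly_Mapping"
    "HOL-Library.Product_Plus"
    "HOL-Algebra.Algebra"
    "HOL-Algebra.Free_Abelian_Groups"
    "HOL-Algebra.Algebraic_Closure_Type"
    "Jordan_Normal_Form.Missing_VectorSpace"
begin

section \<open>Modules over noncommutative rings\<close>

text \<open>
  The library locale \<^locale>\<open>Module.module\<close> demands a commutative ring of scalars; its record type
  and its notion \<^const>\<open>Module.submodule\<close> do not, and are reused here.
\<close>

locale left_module = R?: ring R + M?: abelian_group M
  for R :: "('a, 'b) ring_scheme" (structure) and M :: "('a, 'c, 'd) module_scheme" (structure) +
  assumes smult_closed:
      "\<lbrakk>a \<in> carrier R; x \<in> carrier M\<rbrakk> \<Longrightarrow> a \<odot>\<^bsub>M\<^esub> x \<in> carrier M"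
    and smult_l_distr:
      "\<lbrakk>a \<in> carrier R; b \<in> carrier R; x \<in> carrier M\<rbrakk> \<Longrightarrow>
        (a \<oplus>\<^bsub>R\<^esub> b) \<odot>\<^bsub>M\<^esub> x = a \<odot>\<^bsub>M\<^esub> x \<oplus>\<^bsub>M\<^esub> b \<odot>\<^bsub>M\<^esub> x"
    and smult_r_distr:
      "\<lbrakk>a \<in> carrier R; x \<in> carrier M; y \<in> carrier M\<rbrakk> \<Longrightarrow>
        a \<odot>\<^bsub>M\<^esub> (x \<oplus>\<^bsub>M\<^esub> y) = a \<odot>\<^bsub>M\<^esub> x \<oplus>\<^bsub>M\<^esub> a \<odot>\<^bsub>M\<^esub> y"
    and smult_assoc1:
      "\<lbrakk>a \<in> carrier R; b \<in> carrier R; x \<in> carrier M\<rbrakk> \<Longrightarrow>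
        (a \<otimes>\<^bsub>R\<^esub> b) \<odot>\<^bsub>M\<^esub> x = a \<odot>\<^bsub>M\<^esub> (b \<odot>\<^bsub>M\<^esub> x)"
    and smult_one:
      "x \<in> carrier M \<Longrightarrow> \<one>\<^bsub>R\<^esub> \<odot>\<^bsub>M\<^esub> x = x"

definition irreducible_submodule ::
    "'c set \<Rightarrow> ('a, 'b) ring_scheme \<Rightarrow> ('a, 'c, 'd) module_scheme \<Rightarrow> bool" where
  "irreducible_submodule N R M \<longleftrightarrow>
     Module.submodule N R M \<and> N \<noteq> {\<zero>\<^bsub>M\<^esub>} \<and>
     (\<forall>L. Module.submodule L R M \<and> L \<subseteq> N \<longrightarrow> L = {\<zero>\<^bsub>M\<^esub>} \<or> L = N)"

subsection \<open>Extension of scalars\<close>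

text \<open>
  For a subring \<open>S\<close> of \<open>R\<close> and a left \<open>S\<close>-module \<open>V\<close>, the tensor product of \<open>R\<close> and \<open>V\<close> over \<open>S\<close> is
  the free abelian group on the pairs \<open>(a, v)\<close> modulo biadditivity and \<open>S\<close>-balancedness.
\<close>

definition tensor_relations ::
    "('a, 'b) ring_scheme \<Rightarrow> 'a set \<Rightarrow> ('a, 'c, 'd) module_scheme \<Rightarrow> ('a \<times> 'c \<Rightarrow>\<^sub>0 int) set" where
  "tensor_relations R S V =
     {frag_of (a \<oplus>\<^bsub>R\<^esub> b, v) - frag_of (a, v) - frag_of (b, v) | a b v.
        a \<in> carrier R \<and> b \<in> carrier R \<and> v \<in> carrier V} \<union>
     {frag_of (a, v \<oplus>\<^bsub>V\<^esub> w) - frag_of (a, v) - frag_of (a, w) | a v w.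
        a \<in> carrier R \<and> v \<in> carrier V \<and> w \<in> carrier V} \<union>
     {frag_of (a \<otimes>\<^bsub>R\<^esub> s, v) - frag_of (a, s \<odot>\<^bsub>V\<^esub> v) | a s v.
        a \<in> carrier R \<and> s \<in> S \<and> v \<in> carrier V}"

abbreviation tensor_free ::
    "('a, 'b) ring_scheme \<Rightarrow> ('a, 'c, 'd) module_scheme \<Rightarrow> ('a \<times> 'c \<Rightarrow>\<^sub>0 int) monoid" where
  "tensor_free R V \<equiv> free_Abelian_group (carrier R \<times> carrier V)"

definition tensor_kernel ::
    "('a, 'b) ring_scheme \<Rightarrow> 'a set \<Rightarrow> ('a, 'c, 'd) module_scheme \<Rightarrow> ('a \<times> 'c \<Rightarrow>\<^sub>0 int) set" where
  "tensor_kernel R S V = generate (tensor_free R V) (tensor_relations R S V)"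

text \<open>
  Scalars act on the left tensor factor; the union below runs over the representatives of a coset
  and is a single coset. The fields \<open>mult\<close> and \<open>one\<close> of a module record carry no meaning.
\<close>

definition induced_module ::
    "('a, 'b) ring_scheme \<Rightarrow> 'a set \<Rightarrow> ('a, 'c, 'd) module_scheme \<Rightarrow>
     ('a, ('a \<times> 'c \<Rightarrow>\<^sub>0 int) set) module" where
  "induced_module R S V =
     (let F = tensor_free R V; K = tensor_kernel R S V
      in \<lparr>carrier = carrier (F Mod K), monoid.mult = undefined, one = undefined,
          ring.zero = \<one>\<^bsub>F Mod K\<^esub>, ring.add = (\<lambda>x y. x \<otimes>\<^bsub>F Mod K\<^esub> y),
          module.smult = (\<lambda>r C. \<Union>c\<in>C. K #>\<^bsub>F\<^esub> frag_extend (\<lambda>(a, v). frag_of (r \<otimes>\<^bsub>R\<^esub> a, v)) c)\<rparr>)"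


section \<open>The affine Hecke algebra of type \<open>G\<^sub>2\<close>\<close>

subsection \<open>Root system and weights\<close>

datatype node = N1 | N2

text \<open>The pair \<open>(a, b)\<close> stands for the weight \<open>a \<alpha>\<^sub>1 + b \<alpha>\<^sub>2\<close>.\<close>

type_synonym wlat = "int \<times> int"

fun simple_root :: "node \<Rightarrow> wlat" where
  "simple_root N1 = (1, 0)"
| "simple_root N2 = (0, 1)"

text \<open>\<open>cartan i j\<close> is the pairing of \<open>\<alpha>\<^sub>i\<close> with the coroot of \<open>\<alpha>\<^sub>j\<close>.\<close>

fun cartan :: "node \<Rightarrow> node \<Rightarrow> int" where
  "cartan N1 N1 = 2"
| "cartan N1 N2 = -1"
| "cartan N2 N1 = -3"
| "cartan N2 N2 = 2"

definition coroot_pairing :: "wlat \<Rightarrow> node \<Rightarrow> int" where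
  "coroot_pairing l i = fst l * cartan N1 i + snd l * cartan N2 i"

definition simple_refl :: "node \<Rightarrow> wlat \<Rightarrow> wlat" where
  "simple_refl i l =
     l - (coroot_pairing l i * fst (simple_root i), coroot_pairing l i * snd (simple_root i))"

definition w0 :: "wlat \<Rightarrow> wlat" where
  "w0 = simple_refl N1 \<circ> simple_refl N2 \<circ> simple_refl N1 \<circ>
        simple_refl N2 \<circ> simple_refl N1 \<circ> simple_refl N2"

text \<open>
  A point \<open>t\<close> of the torus is written as the function sending \<open>\<lambda>\<close> to \<open>t(X\<^sup>\<lambda>)\<close>; Weyl group elements
  are bijections of the weight lattice.
\<close>

definition torus_point :: "complex \<Rightarrow> complex \<Rightarrow> wlat \<Rightarrow> complex" where
  "torus_point z w l = z powi fst l * w powi snd l"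

definition weyl_act :: "(wlat \<Rightarrow> wlat) \<Rightarrow> (wlat \<Rightarrow> complex) \<Rightarrow> wlat \<Rightarrow> complex" where
  "weyl_act w t l = t (inv_into UNIV w l)"

subsection \<open>The group algebra of the weight lattice\<close>

type_synonym group_alg = "wlat \<Rightarrow>\<^sub>0 complex"

abbreviation gX :: "wlat \<Rightarrow> group_alg" where
  "gX l \<equiv> Poly_Mapping.single l 1"

text \<open>\<open>bernstein_quotient i l f\<close>: \<open>f\<close> is the quotient
  \<open>(X\<^sup>\<lambda> - X\<^sup>s\<^sup>\<lambda>) / (1 - X\<^sup>-\<^sup>\<alpha>)\<close> in the group algebra, for \<open>s = s\<^sub>i\<close> and \<open>\<alpha> = \<alpha>\<^sub>i\<close>.
  It exists and is unique, see \<open>bernstein_quotient_ex1\<close> below.\<close>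

definition bernstein_quotient :: "node \<Rightarrow> wlat \<Rightarrow> group_alg \<Rightarrow> bool" where
  "bernstein_quotient i l f \<longleftrightarrow> f * (1 - gX (- simple_root i)) = gX l - gX (simple_refl i l)"

subsection \<open>Free associative algebras\<close>

datatype 'g free_mon = Word "'g list"

instantiation free_mon :: (type) monoid_add
begin
definition zero_free_mon :: "'a free_mon" where "0 = Word []"
fun plus_free_mon :: "'a free_mon \<Rightarrow> 'a free_mon \<Rightarrow> 'a free_mon" where
  "Word u + Word v = Word (u @ v)"
instance
proof
  fix a b c :: "'a free_mon"
  show "a + b + c = a + (b + c)" by (cases a; cases b; cases c) simp
  show "0 + a = a" "a + 0 = a" by (cases a; simp add: zero_free_mon_def)+
qed
end

text \<open>The product of finitely supported functions on a monoid is convolution.\<close>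

type_synonym 'g free_alg = "'g free_mon \<Rightarrow>\<^sub>0 complex"

definition free_gen :: "'g \<Rightarrow> 'g free_alg" where
  "free_gen g = Poly_Mapping.single (Word [g]) 1"

definition free_scalar :: "complex \<Rightarrow> 'g free_alg" where
  "free_scalar c = Poly_Mapping.single 0 c"

subsection \<open>Generators and relations\<close>

datatype gen = GT node | GX wlat

abbreviation fT :: "node \<Rightarrow> gen free_alg" where "fT i \<equiv> free_gen (GT i)"
abbreviation fX :: "wlat \<Rightarrow> gen free_alg" where "fX l \<equiv> free_gen (GX l)"

definition group_alg_lift :: "group_alg \<Rightarrow> gen free_alg" where
  "group_alg_lift f =
     (\<Sum>l\<in>Poly_Mapping.keys f. free_scalar (Poly_Mapping.lookup f l) * fX l)"

definition hecke_relators :: "complex \<Rightarrow> gen free_alg set" where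
  "hecke_relators q =
     {fX 0 - 1} \<union>
     {fX l * fX m - fX (l + m) | l m. True} \<union>
     {fT i * fT i - (free_scalar (q - inverse q) * fT i + 1) | i. True} \<union>
     {fT N1 * fT N2 * fT N1 * fT N2 * fT N1 * fT N2
        - fT N2 * fT N1 * fT N2 * fT N1 * fT N2 * fT N1} \<union>
     {fX l * fT i
        - (fT i * fX (simple_refl i l) + free_scalar (q - inverse q) * group_alg_lift f)
      | i l f. bernstein_quotient i l f}"

definition hecke_ideal :: "complex \<Rightarrow> gen free_alg set" where
  "hecke_ideal q = Idl\<^bsub>ring_of_type_algebra\<^esub> (hecke_relators q)"

definition hecke :: "complex \<Rightarrow> gen free_alg set ring" where
  "hecke q = ring_of_type_algebra Quot (hecke_ideal q)"

definition hecke_class :: "complex \<Rightarrow> gen free_alg \<Rightarrow> gen free_alg set" where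
  "hecke_class q f = hecke_ideal q +>\<^bsub>ring_of_type_algebra\<^esub> f"

abbreviation hT :: "complex \<Rightarrow> node \<Rightarrow> gen free_alg set" where
  "hT q i \<equiv> hecke_class q (fT i)"

abbreviation hX :: "complex \<Rightarrow> wlat \<Rightarrow> gen free_alg set" where
  "hX q l \<equiv> hecke_class q (fX l)"

abbreviation hscalar :: "complex \<Rightarrow> complex \<Rightarrow> gen free_alg set" where
  "hscalar q c \<equiv> hecke_class q (free_scalar c)"

text \<open>
  The subring generated by \<open>T\<^sub>i\<close> and the image of the group algebra; since the latter contains
  the scalars, this is the generated subalgebra.
\<close>

definition hecke_parabolic :: "complex \<Rightarrow> node \<Rightarrow> gen free_alg set set" where
  "hecke_parabolic q i =
     generate_ring (hecke q) (insert (hT q i) (range (\<lambda>f. hecke_class q (group_alg_lift f))))"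

subsection \<open>Complex dimension\<close>

definition complex_space ::
    "complex \<Rightarrow> (gen free_alg set, 'v, 'm) module_scheme \<Rightarrow> (complex, 'v) module" where
  "complex_space q M =
     \<lparr>carrier = carrier M, monoid.mult = monoid.mult M, one = one M,
      ring.zero = ring.zero M, ring.add = ring.add M,
      module.smult = (\<lambda>c x. hscalar q c \<odot>\<^bsub>M\<^esub> x)\<rparr>"

definition has_complex_dim ::
    "complex \<Rightarrow> (gen free_alg set, 'v, 'm) module_scheme \<Rightarrow> 'v set \<Rightarrow> nat \<Rightarrow> bool" where
  "has_complex_dim q M N n \<longleftrightarrow>
     (let C = ring_of_type_algebra :: complex ring; V = (complex_space q M)\<lparr>carrier := N\<rparr>
      in vectorspace C V \<and> vectorspace.fin_dim C V \<and> vectorspace.dim C V = n)"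

subsection \<open>One-dimensional modules\<close>

text \<open>
  \<open>V\<close> is a one-dimensional module over the parabolic subalgebra of node \<open>i\<close>, spanned by \<open>v\<close>, with
  \<open>T\<^sub>i v = c v\<close> and \<open>X\<^sup>\<lambda> v = t(X\<^sup>\<lambda>) v\<close>.
\<close>

definition one_dim_module ::
    "complex \<Rightarrow> node \<Rightarrow> (gen free_alg set, 'v) module \<Rightarrow> 'v \<Rightarrow> complex \<Rightarrow> (wlat \<Rightarrow> complex) \<Rightarrow> bool"
  where
  "one_dim_module q i V v c t \<longleftrightarrow>
     left_module ((hecke q)\<lparr>carrier := hecke_parabolic q i\<rparr>) V \<and>
     has_complex_dim q V (carrier V) 1 \<and>
     v \<in> carrier V \<and> v \<noteq> \<zero>\<^bsub>V\<^esub> \<and>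
     hT q i \<odot>\<^bsub>V\<^esub> v = hscalar q c \<odot>\<^bsub>V\<^esub> v \<and>
     (\<forall>l. hX q l \<odot>\<^bsub>V\<^esub> v = hscalar q (t l) \<odot>\<^bsub>V\<^esub> v)"

subsection \<open>Roots of unity\<close>

definition primitive_root_of_unity :: "nat \<Rightarrow> complex \<Rightarrow> bool" where
  "primitive_root_of_unity n z \<longleftrightarrow> n > 0 \<and> z ^ n = 1 \<and> (\<forall>k. 0 < k \<and> k < n \<longrightarrow> z ^ k \<noteq> 1)"


section \<open>Consistency of the definitions\<close>

subsection \<open>The Bernstein quotient and the Hecke ring\<close>

lemma poly_mapping_add_induct [case_names zero single add]:
  fixes f :: "'k \<Rightarrow>\<^sub>0 'c::comm_monoid_add"
  assumes "P 0" and "\<And>k c. P (Poly_Mapping.single k c)" and "\<And>f g. P f \<Longrightarrow> P g \<Longrightarrow> P (f + g)"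
  shows "P f"
proof (induction f rule: update_induct)
  case const
  then show ?case using assms(1) .
next
  case (update f a b)
  have "Poly_Mapping.update a b f = Poly_Mapping.single a b + f"
    using update by (intro poly_mapping_eqI)
      (auto simp: lookup_update lookup_add lookup_single when_def in_keys_iff)
  then show ?case using assms update by metis
qed

lemma lookup_times_single:
  fixes f :: group_alg
  shows "Poly_Mapping.lookup (f * Poly_Mapping.single a c) l = Poly_Mapping.lookup f (l - a) * c"
proof (induction f rule: poly_mapping_add_induct)
  case zero
  then show ?case by simp
next
  case (single k v)
  have "k + a = l \<longleftrightarrow> k = l - a" by (auto simp: algebra_simps)
  then show ?case by (simp add: mult_single lookup_single when_def)
next
  case (add f g)
  then show ?case by (simp add: distrib_right lookup_add)
qed

lemma simple_root_nonzero: "simple_root i \<noteq> 0"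
  by (cases i) (auto simp: zero_prod_def)

lemma group_alg_regular:
  fixes f :: group_alg and a :: wlat
  assumes a: "a \<noteq> 0" and f: "f * (1 - gX (- a)) = 0"
  shows "f = 0"
proof (rule ccontr)
  assume "f \<noteq> 0"
  then obtain l where l: "l \<in> Poly_Mapping.keys f" by (metis keys_eq_empty all_not_in_conv)
  have step: "Poly_Mapping.lookup f (m + a) = Poly_Mapping.lookup f m" for m
  proof -
    have "Poly_Mapping.lookup (f * 1 - f * gX (- a)) m = 0"
      using f by (simp add: right_diff_distrib)
    then show ?thesis by (simp add: lookup_minus lookup_times_single)
  qed
  define s where "s n = l + (int n * fst a, int n * snd a)" for n
  have s: "s n \<in> Poly_Mapping.keys f" for n
  proof (induction n)
    case 0
    then show ?case using l by (simp add: s_def zero_prod_def[symmetric])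
  next
    case (Suc n)
    have "s (Suc n) = s n + a" by (simp add: s_def prod_eq_iff algebra_simps)
    then show ?case using Suc step by (simp add: in_keys_iff)
  qed
  have "inj s"
    using a by (auto simp: s_def inj_def prod_eq_iff)
  then have "infinite (range s)" using finite_imageD infinite_UNIV_nat by blast
  moreover have "range s \<subseteq> Poly_Mapping.keys f" using s by auto
  ultimately show False using finite_subset finite_keys by metis
qed

lemma bernstein_quotient_ex1: "\<exists>!f. bernstein_quotient i l f"
proof (rule ex_ex1I)
  fix f g assume "bernstein_quotient i l f" "bernstein_quotient i l g"
  then have "(f - g) * (1 - gX (- simple_root i)) = 0"
    by (simp add: bernstein_quotient_def left_diff_distrib)
  then show "f = g"
    using group_alg_regular[OF simple_root_nonzero] by fastforce
next
  define a where "a = simple_root i"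
  define sh where "sh k = l - (k * fst a, k * snd a)" for k :: int
  have sh: "gX (sh k) * gX (- a) = gX (sh (k + 1))" for k
  proof -
    have "sh k - a = sh (k + 1)" by (simp add: sh_def algebra_simps prod_eq_iff)
    then show ?thesis by (simp add: mult_single)
  qed
  have dist: "(f + g) * (1 - x) = (f - f * x) + g - g * x" for f g x :: group_alg
    by (simp add: algebra_simps)
  have up: "\<exists>f. f * (1 - gX (- a)) = gX (sh k) - gX (sh (k + int n))" for n k
  proof (induction n)
    case (Suc n)
    then obtain f where "f * (1 - gX (- a)) = gX (sh k) - gX (sh (k + int n))" by blast
    then have f: "f - f * gX (- a) = gX (sh k) - gX (sh (k + int n))"
      by (simp add: right_diff_distrib)
    have "(f + gX (sh (k + int n))) * (1 - gX (- a))
        = (f - f * gX (- a)) + gX (sh (k + int n)) - gX (sh (k + int (Suc n)))"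
      unfolding dist[of f] by (simp add: sh add.assoc add.commute[of 1])
    then have "(f + gX (sh (k + int n))) * (1 - gX (- a)) = gX (sh k) - gX (sh (k + int (Suc n)))"
      unfolding f by simp
    then show ?case by blast
  qed (auto intro: exI[of _ 0])
  have r: "simple_refl i l = sh (coroot_pairing l i)" and l: "l = sh 0"
    by (auto simp: simple_refl_def sh_def a_def zero_prod_def[symmetric])
  show "\<exists>f. bernstein_quotient i l f"
  proof (cases "coroot_pairing l i \<ge> 0")
    case True
    then show ?thesis using up[of 0 "nat (coroot_pairing l i)"] r l
      by (auto simp: bernstein_quotient_def a_def)
  next
    case False
    then obtain f where "f * (1 - gX (- a)) = gX (simple_refl i l) - gX l"
      using up[of "coroot_pairing l i" "nat (- coroot_pairing l i)"] r l by auto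
    then have "(- f) * (1 - gX (- a)) = gX l - gX (simple_refl i l)"
      by (metis minus_diff_eq minus_mult_left)
    then show ?thesis unfolding bernstein_quotient_def a_def by (rule exI)
  qed
qed

lemma ring_free_alg: "ring (ring_of_type_algebra :: 'a::ring_1 ring)"
proof -
  have "\<exists>y. x + y = 0" for x :: 'a
    using add.right_inverse by blast
  then show ?thesis
    unfolding ring_of_type_algebra_def using add.right_inverse
    by unfold_locales (auto simp: algebra_simps Units_def)
qed

lemma ideal_hecke_ideal: "ideal (hecke_ideal q) ring_of_type_algebra"
  unfolding hecke_ideal_def
  by (rule ring.genideal_ideal[OF ring_free_alg]) (simp add: ring_of_type_algebra_def)

lemma ring_hecke: "ring (hecke q)"
  unfolding hecke_def by (rule ideal.quotient_is_ring[OF ideal_hecke_ideal])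

subsection \<open>The one-dimensional modules exist\<close>

definition pm_eval :: "('k \<Rightarrow> complex) \<Rightarrow> ('k \<Rightarrow>\<^sub>0 complex) \<Rightarrow> complex" where
  "pm_eval x f = (\<Sum>k\<in>Poly_Mapping.keys f. Poly_Mapping.lookup f k * x k)"

lemma pm_eval_superset:
  assumes "finite A" "Poly_Mapping.keys f \<subseteq> A"
  shows "pm_eval x f = (\<Sum>k\<in>A. Poly_Mapping.lookup f k * x k)"
  unfolding pm_eval_def using assms by (intro sum.mono_neutral_left) (auto simp: in_keys_iff)

lemma pm_eval_0 [simp]: "pm_eval x 0 = 0"
  by (simp add: pm_eval_def)

lemma pm_eval_single [simp]: "pm_eval x (Poly_Mapping.single k c) = c * x k"
  by (simp add: pm_eval_def)

lemma pm_eval_add: "pm_eval x (f + g) = pm_eval x f + pm_eval x g"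
proof -
  let ?A = "Poly_Mapping.keys f \<union> Poly_Mapping.keys g"
  have "pm_eval x (f + g) = (\<Sum>k\<in>?A. Poly_Mapping.lookup (f + g) k * x k)"
    using keys_add[of f g] by (intro pm_eval_superset) auto
  also have "\<dots> = pm_eval x f + pm_eval x g"
    by (simp add: pm_eval_superset[of ?A] lookup_add distrib_right sum.distrib)
  finally show ?thesis .
qed

lemma pm_eval_diff: "pm_eval x (f - g) = pm_eval x f - pm_eval x g"
  using pm_eval_add[of x "f - g" g] by simp

lemma pm_eval_sum: "pm_eval x (sum f A) = (\<Sum>a\<in>A. pm_eval x (f a))"
  by (induction A rule: infinite_finite_induct) (auto simp: pm_eval_add)

lemma pm_eval_mult:
  fixes x :: "'k::monoid_add \<Rightarrow> complex"
  assumes "\<And>k l. x (k + l) = x k * x l"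
  shows "pm_eval x (f * g) = pm_eval x f * pm_eval x g"
proof (induction f rule: poly_mapping_add_induct)
  case (single k c)
  show ?case
  proof (induction g rule: poly_mapping_add_induct)
    case (single l d)
    then show ?case by (simp add: mult_single assms)
  qed (simp_all add: distrib_left pm_eval_add)
qed (simp_all add: distrib_right pm_eval_add)

fun word_val :: "('g \<Rightarrow> complex) \<Rightarrow> 'g free_mon \<Rightarrow> complex" where
  "word_val x (Word u) = prod_list (map x u)"

lemma word_val_add: "word_val x (u + v) = word_val x u * word_val x v"
  by (cases u; cases v) simp

lemma word_val_0 [simp]: "word_val x 0 = 1"
  by (simp add: zero_free_mon_def)

definition gen_val :: "complex \<Rightarrow> (wlat \<Rightarrow> complex) \<Rightarrow> gen \<Rightarrow> complex" where
  "gen_val c t g = (case g of GT i \<Rightarrow> c | GX l \<Rightarrow> t l)"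

abbreviation free_char :: "complex \<Rightarrow> (wlat \<Rightarrow> complex) \<Rightarrow> gen free_alg \<Rightarrow> complex" where
  "free_char c t \<equiv> pm_eval (word_val (gen_val c t))"

lemma free_char_simps [simp]:
  "free_char c t (f * g) = free_char c t f * free_char c t g"
  "free_char c t (f + g) = free_char c t f + free_char c t g"
  "free_char c t (f - g) = free_char c t f - free_char c t g"
  "free_char c t (free_scalar a) = a"
  "free_char c t (fT i) = c"
  "free_char c t (fX l) = t l"
  "free_char c t 1 = 1"
  by (simp_all add: pm_eval_mult word_val_add pm_eval_add pm_eval_diff free_scalar_def free_gen_def
      gen_val_def flip: single_one)

lemma free_char_lift: "free_char c t (group_alg_lift f) = pm_eval t f"
  by (simp add: group_alg_lift_def pm_eval_sum) (simp add: pm_eval_def)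

locale hecke_character =
  fixes q c :: complex and t :: "wlat \<Rightarrow> complex"
  assumes t_add: "t (l + m) = t l * t m" and t_0: "t 0 = 1"
    and quad: "c * c = (q - inverse q) * c + 1"
    and root: "c * (1 - t (- simple_root i)) = q - inverse q"
    and root_neq: "t (- simple_root i) \<noteq> 1"
begin

lemma free_char_relator: "r \<in> hecke_relators q \<Longrightarrow> free_char c t r = 0"
proof -
  assume "r \<in> hecke_relators q"
  moreover have "t l * c - (c * t (simple_refl i l) + (q - inverse q) * pm_eval t f) = 0"
    if "bernstein_quotient i l f" for i l f
  proof -
    have "pm_eval t f * (1 - t (- simple_root i)) = t l - t (simple_refl i l)"
      using arg_cong[OF that[unfolded bernstein_quotient_def], of "pm_eval t"]
      by (simp add: pm_eval_mult t_add pm_eval_diff t_0 flip: single_one)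
    then have "c * (t l - t (simple_refl i l)) = (q - inverse q) * pm_eval t f"
      using root[of i] by (metis mult.assoc mult.commute)
    then show ?thesis by (simp add: algebra_simps)
  qed
  ultimately show ?thesis
    unfolding hecke_relators_def
    by (auto simp: t_0 quad free_char_lift simp flip: t_add)
qed

lemma free_char_hom: "ring_hom_ring ring_of_type_algebra ring_of_type_algebra (free_char c t)"
  by (intro ring_hom_ringI2 ring_free_alg ring_hom_memI) (auto simp: ring_of_type_algebra_def)

lemma free_char_ideal: "f \<in> hecke_ideal q \<Longrightarrow> free_char c t f = 0"
proof -
  assume f: "f \<in> hecke_ideal q"
  let ?K = "a_kernel ring_of_type_algebra ring_of_type_algebra (free_char c t)"
  have "ideal ?K ring_of_type_algebra"
    by (rule ring_hom_ring.kernel_is_ideal[OF free_char_hom])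
  moreover have "hecke_relators q \<subseteq> ?K"
    using free_char_relator by (auto simp: a_kernel_def' ring_of_type_algebra_def)
  ultimately have "hecke_ideal q \<subseteq> ?K" unfolding hecke_ideal_def
    by (rule ring.genideal_minimal[OF ring_free_alg])
  then show ?thesis using f by (auto simp: a_kernel_def' ring_of_type_algebra_def)
qed

definition char_val :: "gen free_alg set \<Rightarrow> complex" where
  "char_val h = the_elem (free_char c t ` h)"

lemma char_val [simp]: "char_val (hecke_class q f) = free_char c t f"
proof -
  have "0 \<in> hecke_ideal q"
    using additive_subgroup.zero_closed[OF ideal.axioms(1)[OF ideal_hecke_ideal]]
    by (simp add: ring_of_type_algebra_def)
  then have "free_char c t ` hecke_class q f = {free_char c t f}"
    using free_char_ideal
    by (force simp: hecke_class_def a_r_coset_def' ring_of_type_algebra_def)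
  then show ?thesis by (simp add: char_val_def)
qed

lemma hecke_class_ops:
  "hecke_class q f \<oplus>\<^bsub>hecke q\<^esub> hecke_class q g = hecke_class q (f + g)"
  "hecke_class q f \<otimes>\<^bsub>hecke q\<^esub> hecke_class q g = hecke_class q (f * g)"
  "\<one>\<^bsub>hecke q\<^esub> = hecke_class q 1"
  using ring_hom_add[OF ideal.rcos_ring_hom[OF ideal_hecke_ideal[of q]], of f g]
    ring_hom_mult[OF ideal.rcos_ring_hom[OF ideal_hecke_ideal[of q]], of f g]
    ring_hom_one[OF ideal.rcos_ring_hom[OF ideal_hecke_ideal[of q]]]
  by (simp_all add: hecke_def hecke_class_def ring_of_type_algebra_def)

lemma hecke_carrier: "carrier (hecke q) = range (hecke_class q)"
  by (auto simp: hecke_def hecke_class_def FactRing_def A_RCOSETS_def' ring_of_type_algebra_def)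

lemma char_val_add:
  "a \<in> carrier (hecke q) \<Longrightarrow> b \<in> carrier (hecke q) \<Longrightarrow>
    char_val (a \<oplus>\<^bsub>hecke q\<^esub> b) = char_val a + char_val b"
  by (auto simp: hecke_carrier hecke_class_ops)

lemma char_val_mult:
  "a \<in> carrier (hecke q) \<Longrightarrow> b \<in> carrier (hecke q) \<Longrightarrow>
    char_val (a \<otimes>\<^bsub>hecke q\<^esub> b) = char_val a * char_val b"
  by (auto simp: hecke_carrier hecke_class_ops)

lemma char_val_one: "char_val \<one>\<^bsub>hecke q\<^esub> = 1"
  by (simp add: hecke_class_ops)

definition char_module :: "(gen free_alg set, complex) module" where
  "char_module = \<lparr>carrier = UNIV, monoid.mult = (*), one = 1, ring.zero = 0, ring.add = (+),
     module.smult = (\<lambda>h z. char_val h * z)\<rparr>"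

lemma parabolic_subset: "hecke_parabolic q i \<subseteq> carrier (hecke q)"
  unfolding hecke_parabolic_def
  by (rule ring.generate_ring_incl[OF ring_hecke]) (auto simp: hecke_carrier)

lemma ring_parabolic: "ring ((hecke q)\<lparr>carrier := hecke_parabolic q i\<rparr>)"
  unfolding hecke_parabolic_def
  by (rule ring.generate_ring_is_ring[OF ring_hecke]) (auto simp: hecke_carrier)

lemma one_dim_module_char_module: "one_dim_module q i char_module 1 c t"
proof -
  have ag: "abelian_group char_module"
    by (rule abelian_groupI) (auto simp: char_module_def algebra_simps intro: exI[of _ "- _"])
  have "left_module ((hecke q)\<lparr>carrier := hecke_parabolic q i\<rparr>) char_module"
    using ring_parabolic ag subsetD[OF parabolic_subset[of i]]
    by (intro left_module.intro left_module_axioms.intro)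
      (auto simp: char_module_def char_val_add char_val_mult char_val_one algebra_simps)
  moreover have "has_complex_dim q char_module (carrier char_module) 1"
  proof -
    let ?C = "ring_of_type_algebra :: complex ring"
    let ?V = "(complex_space q char_module)\<lparr>carrier := carrier char_module\<rparr>"
    have "abelian_group ?V"
      by (rule abelian_groupI) (auto simp: complex_space_def char_module_def algebra_simps intro: exI[of _ "- _"])
    then have "Module.module ?C ?V"
      by (intro moduleI cring_from_type_algebra)
       (auto simp: complex_space_def char_module_def ring_of_type_algebra_def algebra_simps)
    then interpret vectorspace ?C ?V
      by (intro vectorspace.intro field_from_type_algebra)
    have "z \<in> span {1}" for z
    proof -
      have "lincomb (\<lambda>_. z) {1} = z"
        unfolding lincomb_def
        by (subst M.finsum_insert, simp_all only: M.finsum_empty)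
          (simp_all add: complex_space_def char_module_def)
      then show ?thesis unfolding span_def mem_Collect_eq
        by (intro exI[of _ "\<lambda>_. z"] exI[of _ "{1}"]) (auto simp: ring_of_type_algebra_def)
    qed
    then have g: "gen_set {1}" by (auto simp: complex_space_def char_module_def)
    have "fin_dim" unfolding fin_dim_def using g
      by (intro exI[of _ "{1}"]) (auto simp: complex_space_def char_module_def)
    moreover have "dim = 1" unfolding dim_def
    proof (rule Least_equality)
      show "\<exists>A. finite A \<and> card A = 1 \<and> A \<subseteq> carrier ?V \<and> gen_set A"
        using g by (intro exI[of _ "{1}"]) (auto simp: complex_space_def char_module_def)
    next
      fix n assume "\<exists>A. finite A \<and> card A = n \<and> A \<subseteq> carrier ?V \<and> gen_set A"
      then obtain A where A: "finite A" "card A = n" "gen_set A" by blast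
      have "A \<noteq> {}"
      proof
        assume "A = {}"
        have "(1::complex) \<in> span A" using A(3) by (simp add: complex_space_def char_module_def)
        then obtain a where "1 = lincomb a {}" using \<open>A = {}\<close> unfolding span_def by auto
        also have "lincomb a {} = \<zero>\<^bsub>?V\<^esub>" by (simp only: lincomb_def M.finsum_empty)
        finally show False by (simp add: complex_space_def char_module_def)
      qed
      then show "1 \<le> n" using A by (metis One_nat_def Suc_leI card_gt_0_iff)
    qed
    ultimately show ?thesis
      unfolding has_complex_dim_def Let_def using vectorspace_axioms by simp
  qed
  ultimately show ?thesis
    unfolding one_dim_module_def by (simp add: char_module_def)
qed

end

lemma torus_point_add:
  "z \<noteq> 0 \<Longrightarrow> w \<noteq> 0 \<Longrightarrow> torus_point z w (l + m) = torus_point z w l * torus_point z w m"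
  by (simp add: torus_point_def power_int_add)

lemma one_dim_module_exists_trivial:
  assumes "q \<noteq> 0" "q\<^sup>2 \<noteq> 1"
  shows "\<exists>V :: (gen free_alg set, complex) module. \<exists>v. one_dim_module q i V v q (torus_point (q\<^sup>2) (q\<^sup>2))"
proof -
  interpret hecke_character q q "torus_point (q\<^sup>2) (q\<^sup>2)"
  proof
    fix i
    show "q * (1 - torus_point (q\<^sup>2) (q\<^sup>2) (- simple_root i)) = q - inverse q"
      "torus_point (q\<^sup>2) (q\<^sup>2) (- simple_root i) \<noteq> 1"
      using assms by (cases i; simp add: torus_point_def power_int_minus field_simps power2_eq_square)+
  qed (use assms in \<open>simp_all add: torus_point_add\<close>, simp_all add: torus_point_def algebra_simps)
  show ?thesis using one_dim_module_char_module by blast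
qed

lemma weyl_act_w0: "weyl_act w0 (torus_point z w) = torus_point (inverse z) (inverse w)"
proof -
  have w0: "w0 = uminus"
    by (rule ext) (simp add: w0_def simple_refl_def coroot_pairing_def prod_eq_iff)
  have "inv_into UNIV (uminus :: wlat \<Rightarrow> wlat) = uminus"
    by (rule inv_unique_comp) auto
  then show ?thesis
    by (auto simp: weyl_act_def w0 torus_point_def power_int_minus power_int_inverse)
qed

lemma one_dim_module_exists_sign:
  assumes "q \<noteq> 0" "q\<^sup>2 \<noteq> 1"
  shows "\<exists>V :: (gen free_alg set, complex) module. \<exists>v.
    one_dim_module q i V v (- inverse q) (weyl_act w0 (torus_point (q\<^sup>2) (q\<^sup>2)))"
proof -
  interpret hecke_character q "- inverse q" "torus_point (inverse (q\<^sup>2)) (inverse (q\<^sup>2))"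
  proof
    fix i
    show "- inverse q * (1 - torus_point (inverse (q\<^sup>2)) (inverse (q\<^sup>2)) (- simple_root i)) = q - inverse q"
      "torus_point (inverse (q\<^sup>2)) (inverse (q\<^sup>2)) (- simple_root i) \<noteq> 1"
      using assms by (cases i; simp add: torus_point_def power_int_minus field_simps power2_eq_square)+
  qed (use assms in \<open>simp_all add: torus_point_add\<close>, simp_all add: torus_point_def algebra_simps)
  show ?thesis using one_dim_module_char_module unfolding weyl_act_w0 by blast
qed

subsection \<open>Induced modules are modules\<close>

lemma frag_in_generate:
  fixes S A
  assumes "A \<subseteq> carrier (free_Abelian_group S)"
  defines "K \<equiv> generate (free_Abelian_group S) A"
  shows "0 \<in> K" "x \<in> K \<Longrightarrow> y \<in> K \<Longrightarrow> x + y \<in> K" "x \<in> K \<Longrightarrow> - x \<in> K"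
    "K \<subseteq> carrier (free_Abelian_group S)" "A \<subseteq> K"
proof -
  have sg: "subgroup K (free_Abelian_group S)"
    unfolding K_def by (rule group.generate_is_subgroup[OF group_free_Abelian_group assms(1)])
  show "0 \<in> K" "x \<in> K \<Longrightarrow> y \<in> K \<Longrightarrow> x + y \<in> K" "K \<subseteq> carrier (free_Abelian_group S)"
    using subgroup.one_closed[OF sg] subgroup.m_closed[OF sg] subgroup.subset[OF sg] by auto
  then show "x \<in> K \<Longrightarrow> - x \<in> K"
    using subgroup.m_inv_closed[OF sg, of x] by (auto simp: subset_iff)
  show "A \<subseteq> K" unfolding K_def by (auto intro: generate.incl)
qed

lemma left_module_induced:
  fixes R :: "('a, 'b) ring_scheme" and V :: "('a, 'c, 'd) module_scheme"
  assumes R: "ring R" and S: "subring S R" and V: "left_module (R\<lparr>carrier := S\<rparr>) V"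
  shows "left_module R (induced_module R S V)"
proof -
  interpret R: ring R by fact
  have smult: "s \<odot>\<^bsub>V\<^esub> v \<in> carrier V" if "s \<in> S" "v \<in> carrier V" for s v
    using left_module.smult_closed[OF V] that by simp
  have Vadd: "v \<oplus>\<^bsub>V\<^esub> w \<in> carrier V" if "v \<in> carrier V" "w \<in> carrier V" for v w
    using V that unfolding left_module_def by (simp add: abelian_monoid.a_closed abelian_group_def)
  have SR: "s \<in> carrier R" if "s \<in> S" for s using subringE(1)[OF S] that by auto
  define F where "F = tensor_free R V"
  define T where "T = tensor_relations R S V"
  define K where "K = tensor_kernel R S V"
  define L where "L r = frag_extend (\<lambda>(a, v :: 'c). frag_of (r \<otimes>\<^bsub>R\<^esub> a, v))" for r
  define cs where "cs x = (\<lambda>k. k + x) ` K" for x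
  have Fsimps: "x \<in> carrier F \<longleftrightarrow> Poly_Mapping.keys x \<subseteq> carrier R \<times> carrier V"
    "\<one>\<^bsub>F\<^esub> = 0" "x \<otimes>\<^bsub>F\<^esub> y = x + y" for x y
    by (simp_all add: F_def)
  have Fdiff: "x - y \<in> carrier F" if "x \<in> carrier F" "y \<in> carrier F" for x y
    using that keys_diff[of x y] by (auto simp: Fsimps)
  have Fadd: "x + y \<in> carrier F" if "x \<in> carrier F" "y \<in> carrier F" for x y
    using that keys_add[of x y] by (auto simp: Fsimps)
  have Fof: "frag_of p \<in> carrier F \<longleftrightarrow> p \<in> carrier R \<times> carrier V" for p
    by (simp add: Fsimps)
  have rel: "T \<subseteq> carrier F"
    unfolding T_def tensor_relations_def using SR smult Vadd
    by (auto simp del: frag_of_in_free_Abelian_group intro!: Fdiff simp: Fof)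
  have K: "0 \<in> K" "\<And>x y. x \<in> K \<Longrightarrow> y \<in> K \<Longrightarrow> x + y \<in> K" "\<And>x. x \<in> K \<Longrightarrow> - x \<in> K"
    "K \<subseteq> carrier F" "T \<subseteq> K"
    using frag_in_generate[OF rel[unfolded F_def], folded F_def]
    unfolding K_def tensor_kernel_def T_def F_def by blast+
  have Kdiff: "x - y \<in> K" if "x \<in> K" "y \<in> K" for x y
    using K(2)[OF that(1) K(3)[OF that(2)]] by simp
  have Ladd: "L r (x + y) = L r x + L r y" "L r (x - y) = L r x - L r y" "L r (- x) = - L r x"
    "L r 0 = 0" "L r (frag_of (a, v)) = frag_of (r \<otimes>\<^bsub>R\<^esub> a, v)" for r x y a v
    by (simp_all add: L_def frag_extend_add frag_extend_diff frag_extend_minus)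
  have ind: "P x" if "x \<in> carrier F" "P 0"
    "\<And>a v. a \<in> carrier R \<Longrightarrow> v \<in> carrier V \<Longrightarrow> P (frag_of (a, v))"
    "\<And>x y. P x \<Longrightarrow> P y \<Longrightarrow> P (x - y)" for P x
    using that(1)[unfolded Fsimps] by (induction x rule: frag_induction) (use that in auto)
  have LF: "L r x \<in> carrier F" if "r \<in> carrier R" "x \<in> carrier F" for r x
    using that(2) by (rule ind) (use that(1) in \<open>auto simp: Ladd Fof intro: Fdiff\<close>, simp add: Fsimps)
  have T1: "frag_of (a \<oplus>\<^bsub>R\<^esub> b, v) - frag_of (a, v) - frag_of (b, v) \<in> T"
    if "a \<in> carrier R" "b \<in> carrier R" "v \<in> carrier V" for a b v
    unfolding T_def tensor_relations_def using that by blast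
  have T2: "frag_of (a, v \<oplus>\<^bsub>V\<^esub> w) - frag_of (a, v) - frag_of (a, w) \<in> T"
    if "a \<in> carrier R" "v \<in> carrier V" "w \<in> carrier V" for a v w
    unfolding T_def tensor_relations_def using that by blast
  have T3: "frag_of (a \<otimes>\<^bsub>R\<^esub> s, v) - frag_of (a, s \<odot>\<^bsub>V\<^esub> v) \<in> T"
    if "a \<in> carrier R" "s \<in> S" "v \<in> carrier V" for a s v
    unfolding T_def tensor_relations_def using that by blast
  have LT: "L r x \<in> T" if r: "r \<in> carrier R" and x: "x \<in> T" for r x
  proof -
    have 1: "L r x \<in> T"
      if x: "x \<in> {frag_of (a \<oplus>\<^bsub>R\<^esub> b, v) - frag_of (a, v) - frag_of (b, v) | a b v.
        a \<in> carrier R \<and> b \<in> carrier R \<and> v \<in> carrier V}"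
    proof -
      from x obtain a b v where *: "a \<in> carrier R" "b \<in> carrier R" "v \<in> carrier V"
        "x = frag_of (a \<oplus>\<^bsub>R\<^esub> b, v) - frag_of (a, v) - frag_of (b, v)" by blast
      then show ?thesis using r T1[of "r \<otimes>\<^bsub>R\<^esub> a" "r \<otimes>\<^bsub>R\<^esub> b" v] by (simp add: Ladd R.r_distr)
    qed
    have 2: "L r x \<in> T"
      if x: "x \<in> {frag_of (a, v \<oplus>\<^bsub>V\<^esub> w) - frag_of (a, v) - frag_of (a, w) | a v w.
        a \<in> carrier R \<and> v \<in> carrier V \<and> w \<in> carrier V}"
    proof -
      from x obtain a v w where *: "a \<in> carrier R" "v \<in> carrier V" "w \<in> carrier V"
        "x = frag_of (a, v \<oplus>\<^bsub>V\<^esub> w) - frag_of (a, v) - frag_of (a, w)" by blast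
      then show ?thesis using r T2[of "r \<otimes>\<^bsub>R\<^esub> a" v w] by (simp add: Ladd)
    qed
    have 3: "L r x \<in> T"
      if x: "x \<in> {frag_of (a \<otimes>\<^bsub>R\<^esub> s, v) - frag_of (a, s \<odot>\<^bsub>V\<^esub> v) | a s v.
        a \<in> carrier R \<and> s \<in> S \<and> v \<in> carrier V}"
    proof -
      from x obtain a s v where *: "a \<in> carrier R" "s \<in> S" "v \<in> carrier V"
        "x = frag_of (a \<otimes>\<^bsub>R\<^esub> s, v) - frag_of (a, s \<odot>\<^bsub>V\<^esub> v)" by blast
      then show ?thesis using r T3[of "r \<otimes>\<^bsub>R\<^esub> a" s v] SR by (simp add: Ladd R.m_assoc)
    qed
    show ?thesis
      using x[unfolded T_def tensor_relations_def] by (elim UnE) (erule 1, erule 2, erule 3)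
  qed
  have LK: "L r x \<in> K" if r: "r \<in> carrier R" and x: "x \<in> K" for r x
    using x[unfolded K_def tensor_kernel_def]
  proof (induction rule: generate.induct)
    case one
    then show ?case using K(1) by (simp add: Ladd)
  next
    case (incl h)
    then show ?case using LT[OF r] K(5) by (auto simp: T_def)
  next
    case (inv h)
    then have "h \<in> T" by (simp add: T_def)
    moreover from this have "Poly_Mapping.keys h \<subseteq> carrier R \<times> carrier V"
      using rel Fsimps by blast
    ultimately show ?case using LT[OF r] K(3,5) by (auto simp: Ladd)
  next
    case (eng h1 h2)
    then show ?case using K(2) by (simp add: Ladd)
  qed
  have cs_le: "cs x \<subseteq> cs y" if "x - y \<in> K" for x y
  proof
    fix z assume "z \<in> cs x"
    then obtain k where k: "k \<in> K" "z = k + x" by (auto simp: cs_def)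
    then have "z = (k + (x - y)) + y" by simp
    then show "z \<in> cs y" unfolding cs_def using K(2)[OF k(1) that] by blast
  qed
  have cs_eq: "cs x = cs y" if "x - y \<in> K" for x y
    using cs_le[OF that] cs_le[of y x] K(3)[OF that] by simp
  have rc: "K #>\<^bsub>F\<^esub> x = cs x" for x by (auto simp: r_coset_def cs_def Fsimps)
  have car: "carrier (F Mod K) = cs ` carrier F" by (auto simp: FactGroup_def RCOSETS_def rc)
  have mul: "cs x \<otimes>\<^bsub>F Mod K\<^esub> cs y = cs (x + y)" for x y
  proof
    show "cs x \<otimes>\<^bsub>F Mod K\<^esub> cs y \<subseteq> cs (x + y)"
    proof
      fix z assume "z \<in> cs x \<otimes>\<^bsub>F Mod K\<^esub> cs y"
      then obtain k m where "k \<in> K" "m \<in> K" "z = (k + m) + (x + y)"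
        by (auto simp: FactGroup_def set_mult_def cs_def Fsimps algebra_simps)
      then show "z \<in> cs (x + y)" using K(2) by (auto simp: cs_def)
    qed
    show "cs (x + y) \<subseteq> cs x \<otimes>\<^bsub>F Mod K\<^esub> cs y"
    proof
      fix z assume "z \<in> cs (x + y)"
      then obtain k where "k \<in> K" "z = (k + x) + (0 + y)" by (auto simp: cs_def algebra_simps)
      then show "z \<in> cs x \<otimes>\<^bsub>F Mod K\<^esub> cs y" using K(1)
        by (force simp: FactGroup_def set_mult_def cs_def Fsimps)
    qed
  qed
  have one: "\<one>\<^bsub>F Mod K\<^esub> = cs 0" by (simp add: FactGroup_def cs_def)
  define M where "M = induced_module R S V"
  have M: "carrier M = cs ` carrier F" "\<zero>\<^bsub>M\<^esub> = cs 0" "cs x \<oplus>\<^bsub>M\<^esub> cs y = cs (x + y)" for x y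
    unfolding M_def induced_module_def Let_def F_def[symmetric] K_def[symmetric]
    by (simp_all add: car one mul del: mult_FactGroup one_FactGroup)
  have act: "r \<odot>\<^bsub>M\<^esub> cs x = cs (L r x)" if "r \<in> carrier R" for r x
  proof -
    have "r \<odot>\<^bsub>M\<^esub> cs x = (\<Union>c\<in>cs x. cs (L r c))"
      unfolding M_def induced_module_def Let_def F_def[symmetric] K_def[symmetric] L_def[symmetric]
      by (simp add: rc)
    have const: "cs (L r c) = cs (L r x)" if "c \<in> cs x" for c
    proof -
      obtain k where "k \<in> K" "c = k + x" using \<open>c \<in> cs x\<close> by (auto simp: cs_def)
      then show ?thesis using LK[OF \<open>r \<in> carrier R\<close>] by (intro cs_eq) (simp add: Ladd)
    qed
    have "x \<in> cs x" using K(1) by (force simp: cs_def)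
    then have "(\<Union>c\<in>cs x. cs (L r c)) = cs (L r x)"
      by (rule UN_constant_eq) (intro ballI const)
    with \<open>r \<odot>\<^bsub>M\<^esub> cs x = (\<Union>c\<in>cs x. cs (L r c))\<close> show ?thesis by (rule trans)
  qed
  have "abelian_group M"
  proof (rule abelian_groupI)
    fix Z assume "Z \<in> carrier M"
    then obtain x where x: "x \<in> carrier F" "Z = cs x" by (auto simp: M)
    have "- x \<in> carrier F" using x by (simp add: Fsimps)
    then show "\<exists>Y\<in>carrier M. Y \<oplus>\<^bsub>M\<^esub> Z = \<zero>\<^bsub>M\<^esub>"
      using x by (intro bexI[of _ "cs (- x)"]) (auto simp: M)
  qed (auto simp: M Fadd algebra_simps, simp add: Fsimps)
  moreover have Lsum: "L (a \<oplus>\<^bsub>R\<^esub> b) x - (L a x + L b x) \<in> K"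
    if ab: "a \<in> carrier R" "b \<in> carrier R" and x: "x \<in> carrier F" for a b x
    using x
  proof (rule ind)
    fix c v assume cv: "c \<in> carrier R" "v \<in> carrier V"
    have "frag_of (a \<otimes>\<^bsub>R\<^esub> c \<oplus>\<^bsub>R\<^esub> b \<otimes>\<^bsub>R\<^esub> c, v) - frag_of (a \<otimes>\<^bsub>R\<^esub> c, v) - frag_of (b \<otimes>\<^bsub>R\<^esub> c, v) \<in> T"
      using cv ab by (intro T1) auto
    then show "L (a \<oplus>\<^bsub>R\<^esub> b) (frag_of (c, v)) - (L a (frag_of (c, v)) + L b (frag_of (c, v))) \<in> K"
      using cv ab K(5) by (auto simp: Ladd R.l_distr diff_diff_eq)
  next
    fix x y
    assume *: "L (a \<oplus>\<^bsub>R\<^esub> b) x - (L a x + L b x) \<in> K" "L (a \<oplus>\<^bsub>R\<^esub> b) y - (L a y + L b y) \<in> K"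
    have "L (a \<oplus>\<^bsub>R\<^esub> b) (x - y) - (L a (x - y) + L b (x - y))
      = L (a \<oplus>\<^bsub>R\<^esub> b) x - (L a x + L b x) - (L (a \<oplus>\<^bsub>R\<^esub> b) y - (L a y + L b y))"
      by (simp add: Ladd)
    then show "L (a \<oplus>\<^bsub>R\<^esub> b) (x - y) - (L a (x - y) + L b (x - y)) \<in> K"
      using Kdiff[OF *] by simp
  qed (simp add: Ladd K)
  moreover have "L (a \<otimes>\<^bsub>R\<^esub> b) x = L a (L b x)"
    if ab: "a \<in> carrier R" "b \<in> carrier R" and x: "x \<in> carrier F" for a b x
    using x by (rule ind) (use ab in \<open>auto simp: Ladd R.m_assoc\<close>)
  moreover have "L \<one>\<^bsub>R\<^esub> x = x" if x: "x \<in> carrier F" for x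
    using x by (rule ind) (auto simp: Ladd)
  ultimately have "left_module R M"
    using R by (intro left_module.intro left_module_axioms.intro)
      (auto simp: M act LF Ladd cs_eq[OF Lsum])
  then show ?thesis by (simp add: M_def)
qed

end

theory Submission
  imports Defs
begin

text \<open>
  Part (b) is part (a) in disguise. The relations of the affine Hecke algebra contain \<open>q\<close> only
  through \<open>q - q\<^sup>-\<^sup>1\<close>, which does not change when \<open>q\<close> is replaced by \<open>-q\<^sup>-\<^sup>1\<close>. So both parameters
  define the same algebra, and since \<open>w\<^sub>0 = -1\<close> the replacement turns the eigenvalue \<open>q\<close> and the
  weight \<open>t\<close> into \<open>-q\<^sup>-\<^sup>1\<close> and \<open>w\<^sub>0t\<close>; it also keeps the condition on \<open>q\<^sup>2\<close>.

  For part (a) put \<open>x = q\<^sup>2\<close> and \<open>\<tau>\<^sub>i = q T\<^sub>i\<close>. The vectors obtained from \<open>v\<^sub>t\<close> by applying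
  \<open>\<tau>\<^sub>2, \<tau>\<^sub>1, \<tau>\<^sub>2, \<tau>\<^sub>1, \<tau>\<^sub>2\<close> in turn span \<open>M\<close> together with \<open>v\<^sub>t\<close>, so \<open>M\<close> has dimension at most
  \<open>6\<close>. The weights of \<open>M\<close> are the \<open>wt\<close> for the six elements \<open>w\<close> that are shortest in their cosets of
  \<open>\<langle>s\<^sub>1\<rangle>\<close>. The root \<open>3\<alpha>\<^sub>1 + 2\<alpha>\<^sub>2\<close> has height \<open>5\<close> and \<open>x\<^sup>5 = 1\<close>, so its reflection fixes \<open>t\<close>;
  since this root is orthogonal to \<open>\<alpha>\<^sub>1\<close>, right multiplication by the reflection permutes
  these six elements. The six weights therefore collide in pairs, at
  \<open>t\<^sub>x\<^sub>,\<^sub>x\<close>, at \<open>(x\<^sup>2, x\<^sup>4)\<close> and at \<open>(x\<^sup>3, 1)\<close>. At the last two the torus does not act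
  semisimply, but at \<open>t\<close> it acts by scalars, and \<open>M\<close> is the direct sum of the trivial
  representation and a representation of dimension \<open>5\<close>.

  The proof produces this decomposition from an explicit model. On \<open>\<complex>\<^sup>6 = \<complex>\<^sup>5 \<oplus> \<complex>\<close>, written in a
  basis of generalised weight vectors, \<open>\<tau>\<^sub>1\<close>, \<open>\<tau>\<^sub>2\<close> and the torus are given by matrices over \<open>\<int>[x]\<close>.
  The Bernstein relation is multiplicative in the weight, so it has to be checked on the two
  fundamental weights only (\<open>bernstein_rel_all\<close>, \<open>hecke_rep_model\<close>). The universal property of
  the tensor product gives an equivariant map from \<open>M\<close> to the model
  (\<open>induced_map_app\<close>). The six spanning vectors have linearly independent images
  (\<open>model_basis_independent\<close>), so the map is injective, and \<open>M'\<close> is the preimage of \<open>\<complex>\<^sup>5\<close>.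

  Irreducibility is a statement about \<open>\<complex>\<^sup>5\<close> (\<open>five_irreducible\<close>): every nonzero vector can be
  moved into the weight space at \<open>(x\<^sup>3, 1)\<close>. The subalgebra of node \<open>2\<close> acts irreducibly on that space
  because \<open>\<alpha>\<^sub>2\<close> takes the value \<open>1\<close> there, and \<open>T\<^sub>1\<close> and \<open>T\<^sub>2\<close> lead from it to the rest.
\<close>

section \<open>Representations of the affine Hecke algebra\<close>

text \<open>
  The operators \<open>Y \<lambda>\<close> are the action of \<open>X\<^sup>\<lambda>\<close>. The weights \<open>2\<alpha>\<^sub>1 + \<alpha>\<^sub>2\<close> and \<open>3\<alpha>\<^sub>1 + 2\<alpha>\<^sub>2\<close> are the
  fundamental weights. Each pairs to \<open>0\<close> with one simple coroot and to \<open>1\<close> with the other, so its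
  Bernstein quotients are \<open>0\<close> and \<open>X\<^sup>\<lambda>\<close>, and the last four assumptions are the
  Bernstein relations for them.
\<close>

locale hecke_rep = vector_space scale
  for scale :: "complex \<Rightarrow> 'e::ab_group_add \<Rightarrow> 'e" (infixr \<open>*s\<close> 75) +
  fixes q :: complex and T :: "node \<Rightarrow> 'e \<Rightarrow> 'e" and Y :: "wlat \<Rightarrow> 'e \<Rightarrow> 'e"
  assumes T_add: "T i (u + v) = T i u + T i v"
    and T_scale: "T i (z *s u) = z *s T i u"
    and Y_add: "Y l (u + v) = Y l u + Y l v"
    and Y_scale: "Y l (z *s u) = z *s Y l u"
    and Y_0: "Y 0 u = u"
    and Y_Y: "Y l (Y m u) = Y (l + m) u"
    and T_quadratic: "T i (T i u) = (q - inverse q) *s T i u + u"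
    and T_braid: "T N1 (T N2 (T N1 (T N2 (T N1 (T N2 u))))) =
                  T N2 (T N1 (T N2 (T N1 (T N2 (T N1 u)))))"
    and Y2_T1: "Y (3, 2) (T N1 u) = T N1 (Y (3, 2) u)"
    and Y1_T2: "Y (2, 1) (T N2 u) = T N2 (Y (2, 1) u)"
    and Y1_T1: "Y (2, 1) (T N1 u) = T N1 (Y (1, 1) u) + (q - inverse q) *s Y (2, 1) u"
    and Y2_T2: "Y (3, 2) (T N2 u) = T N2 (Y (3, 1) u) + (q - inverse q) *s Y (3, 2) u"
begin

fun gen_op :: "gen \<Rightarrow> 'e \<Rightarrow> 'e" where
  "gen_op (GT i) = T i"
| "gen_op (GX l) = Y l"

fun word_op :: "gen free_mon \<Rightarrow> 'e \<Rightarrow> 'e" where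
  "word_op (Word gs) u = foldr gen_op gs u"

definition rep :: "gen free_alg \<Rightarrow> 'e \<Rightarrow> 'e" where
  "rep f u = (\<Sum>k\<in>Poly_Mapping.keys f. Poly_Mapping.lookup f k *s word_op k u)"

text \<open>On group algebra elements this agrees with \<open>rep\<close> of their lifts, but unlike lifting it is
  compatible with products.\<close>

definition torus_rep :: "group_alg \<Rightarrow> 'e \<Rightarrow> 'e" where
  "torus_rep f u = (\<Sum>l\<in>Poly_Mapping.keys f. Poly_Mapping.lookup f l *s Y l u)"

lemma pm_sum_superset:
  assumes "finite A" "Poly_Mapping.keys f \<subseteq> A"
  shows "(\<Sum>k\<in>Poly_Mapping.keys f. Poly_Mapping.lookup f k *s g k) = (\<Sum>k\<in>A. Poly_Mapping.lookup f k *s g k)"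
  using assms by (intro sum.mono_neutral_left) (auto simp: in_keys_iff)

lemma pm_sum_add:
  "(\<Sum>k\<in>Poly_Mapping.keys (f + f'). Poly_Mapping.lookup (f + f') k *s g k) =
   (\<Sum>k\<in>Poly_Mapping.keys f. Poly_Mapping.lookup f k *s g k) +
   (\<Sum>k\<in>Poly_Mapping.keys f'. Poly_Mapping.lookup f' k *s g k)"
proof -
  let ?A = "Poly_Mapping.keys f \<union> Poly_Mapping.keys f'"
  have "(\<Sum>k\<in>Poly_Mapping.keys (f + f'). Poly_Mapping.lookup (f + f') k *s g k) =
    (\<Sum>k\<in>?A. Poly_Mapping.lookup (f + f') k *s g k)"
    using keys_add[of f f'] by (intro pm_sum_superset) auto
  then show ?thesis
    by (simp add: pm_sum_superset[of ?A f] pm_sum_superset[of ?A f'] lookup_add scale_left_distrib sum.distrib)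
qed

lemma gen_op_add: "gen_op g (u + v) = gen_op g u + gen_op g v"
  by (cases g) (simp_all add: T_add Y_add)

lemma gen_op_scale: "gen_op g (z *s u) = z *s gen_op g u"
  by (cases g) (simp_all add: T_scale Y_scale)

lemma word_op_add: "word_op k (u + v) = word_op k u + word_op k v"
proof (cases k)
  case (Word gs)
  have "foldr gen_op gs (u + v) = foldr gen_op gs u + foldr gen_op gs v"
    by (induction gs) (simp_all add: gen_op_add)
  then show ?thesis by (simp add: Word)
qed

lemma word_op_scale: "word_op k (z *s u) = z *s word_op k u"
proof (cases k)
  case (Word gs)
  have "foldr gen_op gs (z *s u) = z *s foldr gen_op gs u"
    by (induction gs) (simp_all add: gen_op_scale)
  then show ?thesis by (simp add: Word)
qed

lemma word_op_mult: "word_op (k + l) u = word_op k (word_op l u)"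
  by (cases k; cases l) simp

lemma rep_0 [simp]: "rep 0 u = 0"
  by (simp add: rep_def)

lemma rep_single [simp]: "rep (Poly_Mapping.single k c) u = c *s word_op k u"
  by (simp add: rep_def)

lemma rep_add: "rep (f + g) u = rep f u + rep g u"
  unfolding rep_def by (rule pm_sum_add)

lemma rep_diff: "rep (f - g) u = rep f u - rep g u"
  using rep_add[of "f - g" g u] by simp

lemma rep_vadd: "rep f (u + v) = rep f u + rep f v"
  by (simp add: rep_def word_op_add scale_right_distrib sum.distrib)

lemma rep_vscale: "rep f (z *s u) = z *s rep f u"
  by (simp add: rep_def word_op_scale scale_sum_right mult.commute)

lemma rep_v0 [simp]: "rep f 0 = 0"
  using rep_vscale[of f 0 0] by simp

lemma rep_vdiff: "rep f (u - v) = rep f u - rep f v"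
  using rep_vadd[of f "u - v" v] by simp

lemma rep_mult: "rep (f * g) u = rep f (rep g u)"
proof (induction f rule: poly_mapping_add_induct)
  case (single k c)
  show ?case
  proof (induction g rule: poly_mapping_add_induct)
    case (single l d)
    then show ?case by (simp add: mult_single word_op_mult word_op_scale)
  qed (simp_all add: distrib_left rep_add rep_vadd word_op_add scale_right_distrib)
qed (simp_all add: distrib_right rep_add)

lemma rep_gens [simp]:
  "rep 1 u = u" "rep (free_scalar c) u = c *s u" "rep (fT i) u = T i u" "rep (fX l) u = Y l u"
  by (simp_all add: free_scalar_def free_gen_def zero_free_mon_def flip: single_one)

lemma rep_closed:
  assumes "0 \<in> L" "\<And>u v. u \<in> L \<Longrightarrow> v \<in> L \<Longrightarrow> u + v \<in> L" "\<And>z u. u \<in> L \<Longrightarrow> z *s u \<in> L"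
    and "\<And>i u. u \<in> L \<Longrightarrow> T i u \<in> L" "\<And>l u. u \<in> L \<Longrightarrow> Y l u \<in> L"
    and "u \<in> L"
  shows "rep f u \<in> L"
proof (induction f rule: poly_mapping_add_induct)
  case (single k z)
  obtain gs where k: "k = Word gs" by (cases k)
  have "gen_op g v \<in> L" if "v \<in> L" for g v using that assms(4,5) by (cases g) auto
  then have "foldr gen_op gs u \<in> L" by (induction gs) (auto simp: assms(6))
  then show ?case using assms(3) by (simp add: k)
qed (use assms in \<open>simp_all add: rep_add\<close>)

lemma torus_rep_0 [simp]: "torus_rep 0 u = 0"
  by (simp add: torus_rep_def)

lemma torus_rep_single [simp]: "torus_rep (Poly_Mapping.single l c) u = c *s Y l u"
  by (simp add: torus_rep_def)

lemma torus_rep_add: "torus_rep (f + g) u = torus_rep f u + torus_rep g u"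
  unfolding torus_rep_def by (rule pm_sum_add)

lemma torus_rep_diff: "torus_rep (f - g) u = torus_rep f u - torus_rep g u"
  using torus_rep_add[of "f - g" g u] by simp

lemma torus_rep_uminus: "torus_rep (- f) u = - torus_rep f u"
  using torus_rep_diff[of 0 f u] by simp

lemma torus_rep_vadd: "torus_rep f (u + v) = torus_rep f u + torus_rep f v"
  by (simp add: torus_rep_def Y_add scale_right_distrib sum.distrib)

lemma torus_rep_mult: "torus_rep (f * g) u = torus_rep f (torus_rep g u)"
proof (induction f rule: poly_mapping_add_induct)
  case (single k c)
  show ?case
  proof (induction g rule: poly_mapping_add_induct)
    case (single l d)
    then show ?case by (simp add: mult_single Y_Y Y_scale)
  next
    case zero
    show ?case using Y_scale[of k 0 0] by simp
  qed (simp_all add: distrib_left torus_rep_add torus_rep_vadd Y_add scale_right_distrib)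
qed (simp_all add: distrib_right torus_rep_add)

lemma rep_group_alg_lift: "rep (group_alg_lift f) u = torus_rep f u"
proof -
  have "rep (sum g A) u = (\<Sum>a\<in>A. rep (g a) u)" if "finite A" for g and A :: "wlat set"
    using that by (induction A rule: finite_induct) (simp_all add: rep_add)
  then show ?thesis by (simp add: group_alg_lift_def rep_mult torus_rep_def)
qed

text \<open>The relation expresses \<open>X\<^sup>\<lambda> T\<^sub>i\<close> through a quotient in the group algebra that is known only by its
  product with \<open>1 - X\<^sup>-\<^sup>\<alpha>\<close>, and \<open>1 - X\<^sup>-\<^sup>\<alpha>\<close> may act non-injectively. So the relation is not derived by
  clearing the denominator: the quotients are carried along with the weights, starting from
  the fundamental weights.\<close>

definition bernstein_rel :: "node \<Rightarrow> wlat \<Rightarrow> bool" where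
  "bernstein_rel i l \<longleftrightarrow> (\<exists>f. bernstein_quotient i l f \<and>
     (\<forall>u. Y l (T i u) = T i (Y (simple_refl i l) u) + (q - inverse q) *s torus_rep f u))"

lemma simple_refl_add: "simple_refl i (l + m) = simple_refl i l + simple_refl i m"
  by (cases i) (simp_all add: simple_refl_def coroot_pairing_def prod_eq_iff algebra_simps)

lemma simple_refl_uminus: "simple_refl i (- l) = - simple_refl i l"
  by (cases i) (simp_all add: simple_refl_def coroot_pairing_def prod_eq_iff algebra_simps)

text \<open>\<open>f\<^sub>\<lambda>\<^sub>+\<^sub>\<mu> = X\<^sup>\<lambda> f\<^sub>\<mu> + f\<^sub>\<lambda> X\<^sup>s\<^sup>\<mu>\<close>, the twisted Leibniz rule of a divided difference.\<close>

lemma bernstein_rel_add: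
  assumes "bernstein_rel i l" "bernstein_rel i m"
  shows "bernstein_rel i (l + m)"
proof -
  obtain f where f: "bernstein_quotient i l f"
    "\<And>u. Y l (T i u) = T i (Y (simple_refl i l) u) + (q - inverse q) *s torus_rep f u"
    using assms(1) unfolding bernstein_rel_def by blast
  obtain g where g: "bernstein_quotient i m g"
    "\<And>u. Y m (T i u) = T i (Y (simple_refl i m) u) + (q - inverse q) *s torus_rep g u"
    using assms(2) unfolding bernstein_rel_def by blast
  define h where "h = gX l * g + f * gX (simple_refl i m)"
  have "h * (1 - gX (- simple_root i))
      = gX l * (g * (1 - gX (- simple_root i))) + (f * (1 - gX (- simple_root i))) * gX (simple_refl i m)"
    by (simp add: h_def algebra_simps)
  also have "\<dots> = gX (l + m) - gX (simple_refl i (l + m))"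
    unfolding f(1)[unfolded bernstein_quotient_def] g(1)[unfolded bernstein_quotient_def]
    by (simp add: mult_single simple_refl_add right_diff_distrib left_diff_distrib)
  finally have "bernstein_quotient i (l + m) h" by (simp add: bernstein_quotient_def)
  moreover have "Y (l + m) (T i u) = T i (Y (simple_refl i (l + m)) u) + (q - inverse q) *s torus_rep h u" for u
    by (simp add: Y_Y[symmetric] g f Y_add Y_scale h_def torus_rep_add torus_rep_mult simple_refl_add
        scale_right_distrib)
  ultimately show ?thesis unfolding bernstein_rel_def by blast
qed

text \<open>The Leibniz rule for \<open>\<lambda> + (-\<lambda>) = 0\<close> forces \<open>f\<^sub>-\<^sub>\<lambda> = - X\<^sup>-\<^sup>\<lambda> f\<^sub>\<lambda> X\<^sup>-\<^sup>s\<^sup>\<lambda>\<close>.\<close>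

lemma bernstein_rel_uminus:
  assumes "bernstein_rel i l"
  shows "bernstein_rel i (- l)"
proof -
  obtain f where f: "bernstein_quotient i l f"
    "\<And>u. Y l (T i u) = T i (Y (simple_refl i l) u) + (q - inverse q) *s torus_rep f u"
    using assms(1) unfolding bernstein_rel_def by blast
  define h where "h = - (gX (- l) * f * gX (- simple_refl i l))"
  have "h * (1 - gX (- simple_root i))
      = - (gX (- l) * gX (- simple_refl i l) * (f * (1 - gX (- simple_root i))))"
    by (simp add: h_def algebra_simps)
  also have "\<dots> = gX (- l) - gX (simple_refl i (- l))"
    using f(1) by (simp add: bernstein_quotient_def mult_single simple_refl_uminus right_diff_distrib)
  finally have "bernstein_quotient i (- l) h" by (simp add: bernstein_quotient_def)
  moreover have "Y (- l) (T i u) = T i (Y (simple_refl i (- l)) u) + (q - inverse q) *s torus_rep h u" for u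
  proof -
    define w where "w = Y (- simple_refl i l) u"
    have u: "u = Y (simple_refl i l) w" by (simp add: w_def Y_Y Y_0)
    have "Y (- l) (Y l (T i w)) = Y (- l) (T i u) + (q - inverse q) *s Y (- l) (torus_rep f w)"
      unfolding f(2) u[symmetric] by (simp add: Y_add Y_scale)
    then have "Y (- l) (T i u) = T i w - (q - inverse q) *s Y (- l) (torus_rep f w)"
      by (simp add: Y_Y Y_0)
    then show ?thesis
      by (simp add: h_def torus_rep_uminus torus_rep_mult simple_refl_uminus flip: w_def)
  qed
  ultimately show ?thesis unfolding bernstein_rel_def by blast
qed

lemma bernstein_rel_fundamental: "bernstein_rel i (2, 1)" "bernstein_rel i (3, 2)"
proof -
  have *: "bernstein_rel N1 (3, 2)" "bernstein_rel N2 (2, 1)"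
    using Y2_T1 Y1_T2 unfolding bernstein_rel_def
    by (auto intro!: exI[of _ 0] simp: bernstein_quotient_def simple_refl_def coroot_pairing_def)
  have "gX (2, 1) * (1 - gX (- simple_root N1)) = gX (2, 1) - gX (simple_refl N1 (2, 1))"
    "gX (3, 2) * (1 - gX (- simple_root N2)) = gX (3, 2) - gX (simple_refl N2 (3, 2))"
    by (simp_all add: right_diff_distrib mult_single simple_refl_def coroot_pairing_def)
  then have "bernstein_rel N1 (2, 1)" "bernstein_rel N2 (3, 2)"
    using Y1_T1 Y2_T2 unfolding bernstein_rel_def bernstein_quotient_def
    by (auto intro!: exI[of _ "gX _"] simp: simple_refl_def coroot_pairing_def)
  with * show "bernstein_rel i (2, 1)" "bernstein_rel i (3, 2)" by (cases i; simp)+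
qed

lemma bernstein_rel_mult:
  assumes "bernstein_rel i (a, b)"
  shows "bernstein_rel i (z * a, z * b)"
proof -
  have nat: "bernstein_rel i (int n * a, int n * b)" for n
  proof (induction n)
    case 0
    have "bernstein_rel i ((a, b) + - (a, b))"
      by (intro bernstein_rel_add bernstein_rel_uminus assms)
    then show ?case by (simp add: zero_prod_def)
  next
    case (Suc n)
    have "(int (Suc n) * a, int (Suc n) * b) = (a, b) + (int n * a, int n * b)"
      by (simp add: algebra_simps)
    then show ?case using bernstein_rel_add[OF assms Suc.IH] by simp
  qed
  show ?thesis
  proof (cases "z \<ge> 0")
    case True
    then show ?thesis using nat[of "nat z"] by simp
  next
    case False
    then show ?thesis using bernstein_rel_uminus[OF nat[of "nat (- z)"]] by simp
  qed
qed

lemma bernstein_rel_all: "bernstein_rel i l"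
proof -
  obtain a b where l: "l = (a, b)" by force
  \<comment> \<open>The coefficients of a weight in the fundamental weights are its pairings with the simple coroots.\<close>
  have "bernstein_rel i (((2 * a - 3 * b) * 2, (2 * a - 3 * b) * 1) + ((2 * b - a) * 3, (2 * b - a) * 2))"
    by (intro bernstein_rel_add bernstein_rel_mult bernstein_rel_fundamental)
  then show ?thesis by (simp add: l algebra_simps)
qed

lemma bernstein:
  assumes "bernstein_quotient i l f"
  shows "Y l (T i u) = T i (Y (simple_refl i l) u) + (q - inverse q) *s torus_rep f u"
  using bernstein_rel_all[of i l] assms bernstein_quotient_ex1[of i l]
  unfolding bernstein_rel_def by blast

lemma rep_relator: "r \<in> hecke_relators q \<Longrightarrow> rep r u = 0"
  unfolding hecke_relators_def
  by (auto simp: rep_diff rep_add rep_mult rep_group_alg_lift Y_0 Y_Y T_quadratic T_braid bernstein)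

lemma rep_hecke_ideal:
  assumes "f \<in> hecke_ideal q"
  shows "rep f u = 0"
proof -
  let ?F = "ring_of_type_algebra :: gen free_alg ring"
  let ?K = "{f. \<forall>u. rep f u = 0}"
  interpret F: ring ?F by (rule ring_free_alg)
  have F: "carrier ?F = UNIV" "f \<oplus>\<^bsub>?F\<^esub> g = f + g" "f \<otimes>\<^bsub>?F\<^esub> g = f * g" "\<zero>\<^bsub>?F\<^esub> = 0" for f g
    by (simp_all add: ring_of_type_algebra_def)
  have inv: "inv\<^bsub>add_monoid ?F\<^esub> f = - f" for f
    using F.minus_equality[of "- f" f] by (simp add: a_inv_def F)
  have "ideal ?K ?F"
  proof (rule idealI)
    show "subgroup ?K (add_monoid ?F)"
    proof (rule subgroup.intro)
      show "inv\<^bsub>add_monoid ?F\<^esub> f \<in> ?K" if "f \<in> ?K" for f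
        using that rep_diff[of 0 f] unfolding inv by simp
    qed (auto simp: F rep_add)
  qed (auto simp: F rep_mult ring_free_alg)
  moreover have "hecke_relators q \<subseteq> ?K" using rep_relator by auto
  ultimately have "hecke_ideal q \<subseteq> ?K" unfolding hecke_ideal_def by (rule F.genideal_minimal)
  then show ?thesis using assms by blast
qed

text \<open>By \<open>rep_hecke_ideal\<close> the action does not depend on the representative of a class.\<close>

definition act :: "gen free_alg set \<Rightarrow> 'e \<Rightarrow> 'e" where
  "act h u = the_elem ((\<lambda>f. rep f u) ` h)"

lemma act_hecke_class [simp]: "act (hecke_class q f) u = rep f u"
proof -
  have "0 \<in> hecke_ideal q"
    using additive_subgroup.zero_closed[OF ideal.axioms(1)[OF ideal_hecke_ideal]]
    by (simp add: ring_of_type_algebra_def)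
  then have "(\<lambda>f. rep f u) ` hecke_class q f = {rep f u}"
    using rep_hecke_ideal
    by (force simp: hecke_class_def a_r_coset_def' ring_of_type_algebra_def rep_add)
  then show ?thesis by (simp add: act_def)
qed

end

section \<open>The six-dimensional model\<close>

text \<open>
  In coordinates \<open>(a, b, c, d, e, f)\<close> the last one carries the trivial representation. The others
  refer to a basis \<open>e\<^sub>0, \<dots>, e\<^sub>4\<close> of generalised weight vectors, with weight \<open>(x, x)\<close> for \<open>e\<^sub>0\<close>,
  \<open>(x\<^sup>2, x\<^sup>4)\<close> for \<open>e\<^sub>1, e\<^sub>2\<close> and \<open>(x\<^sup>3, 1)\<close> for \<open>e\<^sub>3, e\<^sub>4\<close>. Here \<open>e\<^sub>3\<close> is a weight vector,
  \<open>e\<^sub>4 = \<tau>\<^sub>2 e\<^sub>3\<close>, and \<open>e\<^sub>1, e\<^sub>2\<close> are the components of \<open>\<tau>\<^sub>1 e\<^sub>3, \<tau>\<^sub>1 e\<^sub>4\<close> at \<open>(x\<^sup>2, x\<^sup>4)\<close>. The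
  matrices are those of the quotient of the induced module by its trivial submodule.
\<close>

type_synonym e6 = "complex \<times> complex \<times> complex \<times> complex \<times> complex \<times> complex"

fun scale6 :: "complex \<Rightarrow> e6 \<Rightarrow> e6" where
  "scale6 z (a, b, c, d, e, f) = (z * a, z * b, z * c, z * d, z * e, z * f)"

fun tau :: "complex \<Rightarrow> node \<Rightarrow> e6 \<Rightarrow> e6" where
  "tau x N1 (a, b, c, d, e, f) =
     (x * a,
      - (1 + x^3) * b + (1 - x + x^2) * c + d,
      - (1 + x^3) * c + e,
      (1 + x^2) * b + (5 + 2 * x + 2 * x^2 + 5 * x^3) * c + (x + x^3) * d + (x - x^2 - 1) * e,
      (1 + x^2) * c + (x + x^3) * e,
      x * f)"
| "tau x N2 (a, b, c, d, e, f) =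
     (x * a - c, - (x + x^2) * a - b + x * c, - c, x * e, d + (x - 1) * e, x * f)"

text \<open>The nilpotent parts are additive in the weight \<open>(m, n)\<close>. At \<open>(x\<^sup>3, 1)\<close> the functional \<open>m - 2n\<close> vanishes on
  the fundamental weight orthogonal to \<open>\<alpha>\<^sub>2\<close>, because \<open>T\<^sub>2\<close> commutes with that weight; \<open>n - m\<close> is its
  image under \<open>s\<^sub>1\<close>.\<close>

fun torus6 :: "complex \<Rightarrow> wlat \<Rightarrow> e6 \<Rightarrow> e6" where
  "torus6 x (m, n) (a, b, c, d, e, f) =
     (x powi (m + n) * a,
      x powi (2 * m + 4 * n) * (b + of_int (n - m) * (1 - x) * c), x powi (2 * m + 4 * n) * c,
      x powi (3 * m) * (d + of_int (m - 2 * n) * (1 - x) * e), x powi (3 * m) * e,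
      x powi (m + n) * f)"

definition T6 :: "complex \<Rightarrow> node \<Rightarrow> e6 \<Rightarrow> e6" where
  "T6 q i u = scale6 (inverse q) (tau (q\<^sup>2) i u)"

lemma vector_space_scale6: "vector_space scale6"
  by unfold_locales (auto simp: algebra_simps)

lemma tau_add: "tau x i (u + v) = tau x i u + tau x i v"
  by (cases i; cases u; cases v) (simp_all add: algebra_simps)

lemma tau_scale: "tau x i (scale6 z u) = scale6 z (tau x i u)"
  by (cases i; cases u) (simp_all add: algebra_simps)

lemma torus6_add: "torus6 x l (u + v) = torus6 x l u + torus6 x l v"
  by (cases l; cases u; cases v) (simp add: algebra_simps)

lemma torus6_scale: "torus6 x l (scale6 z u) = scale6 z (torus6 x l u)"
  by (cases l; cases u) (simp add: algebra_simps)

abbreviation five :: "e6 set" where "five \<equiv> {(a, b, c, d, e, f). f = 0}"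

definition base6 :: e6 where "base6 = (1, 0, 0, 0, 0, 1)"

locale fifth_root =
  fixes x :: complex
  assumes x: "1 + x + x^2 + x^3 + x^4 = 0"
begin

lemma x4: "x^4 = - (1 + x + x^2 + x^3)"
  using x by (simp add: eq_neg_iff_add_eq_0 algebra_simps)

lemma x_reduce: "x * (x * (x * x)) = - 1 - x - x * x - x * (x * x)"
  using x4 by (simp add: eval_nat_numeral algebra_simps)

lemma x_reduce': "x * (x * (x * (x * z))) = - z - x * z - x * (x * z) - x * (x * (x * z))"
  using arg_cong[OF x_reduce, of "\<lambda>w. w * z"] by (simp add: algebra_simps)

text \<open>Every expression becomes a polynomial of degree at most \<open>3\<close> in \<open>x\<close>, a normal form that decides the
  matrix identities below. The primed rule reduces \<open>x\<^sup>4\<close> in front of further factors.\<close>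

lemmas normalise = algebra_simps power2_eq_square power3_eq_cube x4 x_reduce x_reduce'

lemma x5: "x^5 = 1"
proof -
  have "x^5 - 1 = (x - 1) * (1 + x + x^2 + x^3 + x^4)"
    by (simp add: eval_nat_numeral algebra_simps)
  then show ?thesis using x by simp
qed

lemma x_nonzero: "x \<noteq> 0"
  using x by auto

lemma tau_quadratic: "tau x i (tau x i u) = scale6 (x - 1) (tau x i u) + scale6 x u"
proof -
  obtain a b c d e f where u: "u = (a, b, c, d, e, f)" by (metis prod_cases6)
  show ?thesis
    unfolding u by (cases i; simp add: normalise)
qed

lemma tau_braid:
  "tau x N1 (tau x N2 (tau x N1 (tau x N2 (tau x N1 (tau x N2 u))))) =
   tau x N2 (tau x N1 (tau x N2 (tau x N1 (tau x N2 (tau x N1 u)))))"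
proof -
  obtain a b c d e f where u: "u = (a, b, c, d, e, f)" by (metis prod_cases6)
  show ?thesis
    unfolding u by (simp add: normalise)
qed

lemma torus6_values:
  "torus6 x (2, 1) (a, b, c, d, e, f) = (x^3 * a, x^3 * (b - (1 - x) * c), x^3 * c, x * d, x * e, x^3 * f)"
  "torus6 x (3, 2) (a, b, c, d, e, f) =
     (a, x^4 * (b - (1 - x) * c), x^4 * c, x^4 * (d - (1 - x) * e), x^4 * e, f)"
  "torus6 x (1, 1) (a, b, c, d, e, f) =
     (x^2 * a, x * b, x * c, x^3 * (d - (1 - x) * e), x^3 * e, x^2 * f)"
  "torus6 x (3, 1) (a, b, c, d, e, f) =
     (x^4 * a, b - 2 * (1 - x) * c, c, x^4 * (d + (1 - x) * e), x^4 * e, x^4 * f)"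
proof -
  have "x^6 = x^5 * x" "x^8 = x^5 * x^3" "x^9 = x^5 * x^4" "x^10 = x^5 * x^5" "x^14 = x^5 * x^5 * x^4"
    by (simp_all flip: power_add power_Suc2)
  then show "torus6 x (2, 1) (a, b, c, d, e, f) = (x^3 * a, x^3 * (b - (1 - x) * c), x^3 * c, x * d, x * e, x^3 * f)"
  "torus6 x (3, 2) (a, b, c, d, e, f) =
     (a, x^4 * (b - (1 - x) * c), x^4 * c, x^4 * (d - (1 - x) * e), x^4 * e, f)"
  "torus6 x (1, 1) (a, b, c, d, e, f) =
     (x^2 * a, x * b, x * c, x^3 * (d - (1 - x) * e), x^3 * e, x^2 * f)"
  "torus6 x (3, 1) (a, b, c, d, e, f) =
     (x^4 * a, b - 2 * (1 - x) * c, c, x^4 * (d + (1 - x) * e), x^4 * e, x^4 * f)"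
    by (simp_all add: x5 algebra_simps)
qed

lemma torus6_tau:
  "torus6 x (3, 2) (tau x N1 u) = tau x N1 (torus6 x (3, 2) u)"
  "torus6 x (2, 1) (tau x N2 u) = tau x N2 (torus6 x (2, 1) u)"
  "torus6 x (2, 1) (tau x N1 u) = tau x N1 (torus6 x (1, 1) u) + scale6 (x - 1) (torus6 x (2, 1) u)"
  "torus6 x (3, 2) (tau x N2 u) = tau x N2 (torus6 x (3, 1) u) + scale6 (x - 1) (torus6 x (3, 2) u)"
proof -
  obtain a b c d e f where u: "u = (a, b, c, d, e, f)" by (metis prod_cases6)
  show "torus6 x (3, 2) (tau x N1 u) = tau x N1 (torus6 x (3, 2) u)"
    unfolding u by (simp add: torus6_values normalise del: torus6.simps)
  show "torus6 x (2, 1) (tau x N2 u) = tau x N2 (torus6 x (2, 1) u)"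
    unfolding u by (simp add: torus6_values normalise del: torus6.simps)
  show "torus6 x (2, 1) (tau x N1 u) = tau x N1 (torus6 x (1, 1) u) + scale6 (x - 1) (torus6 x (2, 1) u)"
    unfolding u by (simp add: torus6_values normalise del: torus6.simps)
  show "torus6 x (3, 2) (tau x N2 u) = tau x N2 (torus6 x (3, 1) u) + scale6 (x - 1) (torus6 x (3, 2) u)"
    unfolding u by (simp add: torus6_values normalise del: torus6.simps)
qed

lemma torus6_torus6: "torus6 x l (torus6 x m u) = torus6 x (l + m) u"
proof -
  obtain a b c d e f where u: "u = (a, b, c, d, e, f)" by (metis prod_cases6)
  obtain i j i' j' where l: "l = (i, j)" "m = (i', j')" by (metis prod.exhaust)
  have "x powi (i + i' + (j + j')) = x powi (i + j) * x powi (i' + j')"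
    "x powi (2 * (i + i') + 4 * (j + j')) = x powi (2 * i + 4 * j) * x powi (2 * i' + 4 * j')"
    "x powi (3 * (i + i')) = x powi (3 * i) * x powi (3 * i')"
    using x_nonzero by (simp_all add: algebra_simps flip: power_int_add)
  then show ?thesis unfolding u l by (simp add: algebra_simps)
qed

lemma x_neq: "x \<noteq> 1" "x + x^2 \<noteq> 0" "1 + x^2 \<noteq> 0" "x - x^3 \<noteq> 0"
proof -
  show 1: "x \<noteq> 1" using x by auto
  have m1: "1 + x \<noteq> 0"
  proof
    assume "1 + x = 0"
    then have "x = - 1" by (simp add: eq_neg_iff_add_eq_0 add.commute)
    with x show False by simp
  qed
  have "x + x^2 = x * (1 + x)" by (simp add: normalise)
  then show "x + x^2 \<noteq> 0" using m1 x_nonzero by simp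
  show "1 + x^2 \<noteq> 0"
  proof
    assume *: "1 + x^2 = 0"
    have "1 + x + x^2 + x^3 + x^4 = 1 + (1 + x^2) * (x + x^2)"
      by (simp add: eval_nat_numeral algebra_simps)
    with * x show False by simp
  qed
  have "x - x^3 = x * ((1 - x) * (1 + x))" by (simp add: eval_nat_numeral algebra_simps)
  then show "x - x^3 \<noteq> 0" using 1 m1 x_nonzero by simp
qed

text \<open>Write \<open>L\<^sub>3\<close> for the span of \<open>e\<^sub>3, e\<^sub>4\<close>. A vector with a nonzero component in \<open>L\<^sub>3\<close> is projected to it.
  Otherwise \<open>T\<^sub>1\<close> moves a component at \<open>(x\<^sup>2, x\<^sup>4)\<close> into \<open>L\<^sub>3\<close>, and \<open>T\<^sub>2\<close> moves a component at \<open>(x, x)\<close> to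
  \<open>(x\<^sup>2, x\<^sup>4)\<close>. Inside \<open>L\<^sub>3\<close> the unipotent \<open>X\<^sup>\<alpha>\<^sup>2\<close> leads to \<open>e\<^sub>3\<close>, which generates everything.\<close>

lemma five_irreducible:
  assumes L: "L \<subseteq> five"
    and add: "\<And>u v. u \<in> L \<Longrightarrow> v \<in> L \<Longrightarrow> u + v \<in> L"
    and scale: "\<And>z u. u \<in> L \<Longrightarrow> scale6 z u \<in> L"
    and tau: "\<And>i u. u \<in> L \<Longrightarrow> tau x i u \<in> L"
    and torus: "\<And>l u. u \<in> L \<Longrightarrow> torus6 x l u \<in> L"
    and nonzero: "u \<in> L" "u \<noteq> 0"
  shows "L = five"
proof -
  have generated: "L = five" if "(0, 0, 0, d, e, 0) \<in> L" "d \<noteq> 0 \<or> e \<noteq> 0" for d e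
  proof -
    let ?v = "(0, 0, 0, d, e, 0)"
    have "\<exists>d. d \<noteq> 0 \<and> (0, 0, 0, d, 0, 0) \<in> L"
    proof (cases "e = 0")
      case False
      have "torus6 x (0, 1) ?v + scale6 (- 1) ?v = (0, 0, 0, - 2 * (1 - x) * e, 0, 0)" by simp
      then have "(0, 0, 0, - 2 * (1 - x) * e, 0, 0) \<in> L"
        using add[OF torus scale, OF that(1) that(1), of "(0, 1)" "- 1"] by simp
      then show ?thesis using False x_neq(1) by (intro exI[of _ "- 2 * (1 - x) * e"]) simp
    qed (use that in auto)
    then obtain d' where d': "d' \<noteq> 0" "(0, 0, 0, d', 0, 0) \<in> L" by blast
    have e3: "(0, 0, 0, 1, 0, 0) \<in> L"
      using scale[OF d'(2), of "inverse d'"] d'(1) by simp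
    have e4: "(0, 0, 0, 0, 1, 0) \<in> L" using tau[OF e3, of N2] by simp
    have e1: "(0, 1, 0, 0, 0, 0) \<in> L"
      using add[OF tau[OF e3, of N1] scale[OF e3, of "- (x + x^3)"]] by simp
    have e2: "(0, 0, 1, 0, 0, 0) \<in> L"
      using add[OF tau[OF e4, of N1] add[OF scale[OF e3, of "- (x - x^2 - 1)"] scale[OF e4, of "- (x + x^3)"]]]
      by simp
    have e0: "(1, 0, 0, 0, 0, 0) \<in> L"
      using add[OF scale[OF tau[OF e2, of N2], of "- 1"] add[OF scale[OF e1, of x] scale[OF e2, of "- 1"]]]
      by simp
    have "(a, b, c, d, e, 0) \<in> L" for a b c d e
      using add[OF scale[OF e0, of a] add[OF scale[OF e1, of b] add[OF scale[OF e2, of c]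
          add[OF scale[OF e3, of d] scale[OF e4, of e]]]]] by simp
    then show ?thesis using L by auto
  qed
  have step2: "L = five" if "(a, b, c, d, e, 0) \<in> L" "d \<noteq> 0 \<or> e \<noteq> 0" for a b c d e
  proof -
    \<comment> \<open>\<open>2\<alpha>\<^sub>1 + \<alpha>\<^sub>2\<close> has the eigenvalue \<open>x\<^sup>3\<close> away from \<open>L\<^sub>3\<close>, with nilpotent part of square \<open>0\<close>, and acts on \<open>L\<^sub>3\<close> by \<open>x\<close>.\<close>
    define P where "P u = torus6 x (2, 1) u + scale6 (- (x^3)) u" for u
    have P: "P u \<in> L" if "u \<in> L" for u
      unfolding P_def by (intro add torus scale that)
    have "P (P (a, b, c, d, e, 0)) = (0, 0, 0, (x - x^3)^2 * d, (x - x^3)^2 * e, 0)"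
      by (simp add: P_def torus6_values power2_eq_square algebra_simps del: torus6.simps)
    then have "(0, 0, 0, (x - x^3)^2 * d, (x - x^3)^2 * e, 0) \<in> L" using P[OF P[OF that(1)]] by simp
    then show ?thesis by (rule generated) (use that(2) x_neq(4) in simp)
  qed
  have step1: "L = five" if "(a, b, c, d, e, 0) \<in> L" "b \<noteq> 0 \<or> c \<noteq> 0 \<or> d \<noteq> 0 \<or> e \<noteq> 0" for a b c d e
  proof (cases "d \<noteq> 0 \<or> e \<noteq> 0")
    case False
    with that have *: "(a, b, c, 0, 0, 0) \<in> L" "b \<noteq> 0 \<or> c \<noteq> 0" by auto
    have "tau x N1 (a, b, c, 0, 0, 0) \<in> L" by (rule tau[OF *(1)])
    then show ?thesis unfolding tau.simps mult_zero_right
      by (rule step2) (use *(2) x_neq(3) in \<open>cases "c = 0"; simp\<close>)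
  qed (use that step2 in blast)
  obtain a b c d e where u: "u = (a, b, c, d, e, 0)" using nonzero(1) L by blast
  show ?thesis
  proof (cases "b \<noteq> 0 \<or> c \<noteq> 0 \<or> d \<noteq> 0 \<or> e \<noteq> 0")
    case False
    with u nonzero have *: "(a, 0, 0, 0, 0, 0) \<in> L" "a \<noteq> 0" by (auto simp: zero_prod_def)
    have "tau x N2 (a, 0, 0, 0, 0, 0) \<in> L" by (rule tau[OF *(1)])
    moreover have "tau x N2 (a, 0, 0, 0, 0, 0) = (x * a, - ((x + x^2) * a), 0, 0, 0, 0)"
      by (simp add: algebra_simps)
    moreover have "- ((x + x^2) * a) \<noteq> 0" using *(2) x_neq(2) by (metis mult_eq_0_iff neg_equal_0_iff_equal)
    ultimately show ?thesis using step1 by metis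
  qed (use nonzero u step1 in blast)
qed

text \<open>The images of the spanning vectors of the induced module.\<close>

fun model_basis :: "nat \<Rightarrow> e6" where
  "model_basis 0 = base6"
| "model_basis (Suc k) = tau x (if even k then N2 else N1) (model_basis k)"

lemma model_basis_values:
  "model_basis 0 = (1, 0, 0, 0, 0, 1)"
  "model_basis 1 = (x, - (x + x^2), 0, 0, 0, x)"
  "model_basis 2 = (x^2, - (x^3), 0, 1, 0, x^2)"
  "model_basis 3 = (x^3, 1 + x + x^2 + x^3, 0, 0, 1, x^3)"
  "model_basis 4 = (x^4, - (1 + x + x^3), 1, x + x^3, x + x^3, x^4)"
  "model_basis 5 = (0, x + x^3, - 1, - (1 + x + x^3), - (1 + x + x^3), 1)"
proof -
  have Suc: "2 = Suc 1" "3 = Suc 2" "4 = Suc 3" "5 = Suc 4" by simp_all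
  show 0: "model_basis 0 = (1, 0, 0, 0, 0, 1)" by (simp add: base6_def)
  show 1: "model_basis 1 = (x, - (x + x^2), 0, 0, 0, x)" using model_basis.simps(2)[of 0] by (simp add: base6_def)
  show 2: "model_basis 2 = (x^2, - (x^3), 0, 1, 0, x^2)"
    unfolding Suc(1) model_basis.simps 1 by (simp add: normalise)
  show 3: "model_basis 3 = (x^3, 1 + x + x^2 + x^3, 0, 0, 1, x^3)"
    unfolding Suc(2) model_basis.simps 2 by (simp add: normalise)
  show 4: "model_basis 4 = (x^4, - (1 + x + x^3), 1, x + x^3, x + x^3, x^4)"
    unfolding Suc(3) model_basis.simps 3 by (simp add: normalise)
  show 5: "model_basis 5 = (0, x + x^3, - 1, - (1 + x + x^3), - (1 + x + x^3), 1)"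
    unfolding Suc(4) model_basis.simps 4 by (simp add: normalise)
qed

text \<open>In the first five coordinates the six vectors have sum \<open>0\<close>, and this is their only relation there. In the
  last coordinate it reads \<open>1 + x + \<dots> + x\<^sup>5 = 1\<close>, so it fails: this is where the trivial summand
  splits off.\<close>

lemma model_basis_independent:
  assumes "(\<Sum>k<6. scale6 (c k) (model_basis k)) = 0" and "k < 6"
  shows "c k = 0"
proof -
  have "scale6 (c 0) (model_basis 0) + scale6 (c 1) (model_basis 1) + scale6 (c 2) (model_basis 2)
      + scale6 (c 3) (model_basis 3) + scale6 (c 4) (model_basis 4) + scale6 (c 5) (model_basis 5) = 0"
    using assms(1) by (simp add: eval_nat_numeral lessThan_Suc add_ac del: model_basis.simps)
  note eqs = this[unfolded model_basis_values, simplified]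
  have c4: "c 4 = c 5" using eqs by (simp add: zero_prod_def)
  have "c 3 = c 5"
    using eqs c4 by (simp add: zero_prod_def algebra_simps)
  have "c 2 = c 5"
    using eqs c4 by (simp add: zero_prod_def algebra_simps)
  have "(c 5 - c 1) * (x + x^2) = 0"
    using eqs c4 \<open>c 3 = c 5\<close> \<open>c 2 = c 5\<close> by (simp add: zero_prod_def algebra_simps)
  then have "c 1 = c 5" using x_neq(2) by simp
  have x5: "c 5 * (1 + x + x^2 + x^3 + x^4) = 0" using x by simp
  have "c 0 = 0" "c 0 + c 5 * (x + x^2 + x^3 + x^4) = 0"
    using eqs c4 \<open>c 3 = c 5\<close> \<open>c 2 = c 5\<close> \<open>c 1 = c 5\<close> x5 by (auto simp: zero_prod_def algebra_simps)
  moreover have "c 5 + c 5 * (x + x^2 + x^3 + x^4) = 0" using x5 by (simp add: algebra_simps)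
  ultimately have "c 0 = c 5" by (metis add_right_cancel)
  with \<open>c 0 = 0\<close> have "c 5 = 0" by simp
  moreover have "k \<in> {0, 1, 2, 3, 4, 5}" using assms(2) by auto
  ultimately show ?thesis
    using \<open>c 0 = c 5\<close> \<open>c 1 = c 5\<close> \<open>c 2 = c 5\<close> \<open>c 3 = c 5\<close> c4 by auto
qed

end

lemma hecke_rep_model:
  assumes "q \<noteq> 0" and "fifth_root (q\<^sup>2)"
  shows "hecke_rep scale6 q (T6 q) (torus6 (q\<^sup>2))"
proof -
  interpret fifth_root "q\<^sup>2" by fact
  interpret vector_space scale6 by (rule vector_space_scale6)
  have c: "inverse q * (q\<^sup>2 - 1) = q - inverse q" "inverse q * (inverse q * q\<^sup>2) = 1"
    using assms(1) by (simp_all add: field_simps power2_eq_square)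
  show ?thesis
  proof
    show "torus6 (q\<^sup>2) 0 u = u" for u
      by (cases u) (simp add: zero_prod_def)
    show "T6 q i (T6 q i u) = scale6 (q - inverse q) (T6 q i u) + u" for i u
      by (simp add: T6_def tau_scale tau_quadratic scale_right_distrib c(2) flip: c(1))
    fix u
    show "torus6 (q\<^sup>2) (2, 1) (T6 q N1 u)
        = T6 q N1 (torus6 (q\<^sup>2) (1, 1) u) + scale6 (q - inverse q) (torus6 (q\<^sup>2) (2, 1) u)"
      by (simp add: T6_def torus6_scale torus6_tau scale_right_distrib flip: c(1) del: torus6.simps)
    show "torus6 (q\<^sup>2) (3, 2) (T6 q N2 u)
        = T6 q N2 (torus6 (q\<^sup>2) (3, 1) u) + scale6 (q - inverse q) (torus6 (q\<^sup>2) (3, 2) u)"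
      by (simp add: T6_def torus6_scale torus6_tau scale_right_distrib flip: c(1) del: torus6.simps)
  qed (simp_all add: T6_def tau_add tau_scale tau_braid torus6_add torus6_scale torus6_torus6
        torus6_tau scale_right_distrib mult.commute del: torus6.simps tau.simps)
qed

section \<open>Linear algebra\<close>

abbreviation complex_ring :: "complex ring" where "complex_ring \<equiv> ring_of_type_algebra"

lemma complex_ring_simps:
  "carrier complex_ring = UNIV" "\<zero>\<^bsub>complex_ring\<^esub> = 0" "\<one>\<^bsub>complex_ring\<^esub> = 1"
  "a \<oplus>\<^bsub>complex_ring\<^esub> b = a + b" "a \<otimes>\<^bsub>complex_ring\<^esub> b = a * b"
  by (simp_all add: ring_of_type_algebra_def)

text \<open>The functions vanishing from \<open>n\<close> on serve as \<open>\<complex>\<^sup>n\<close>; the preimages of the unit vectors are a basis.\<close>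

lemma dim_by_coordinates:
  fixes V :: "(complex, 'v, 'm) module_scheme"
  assumes "vectorspace complex_ring V"
    and bij: "bij_betw \<Phi> (carrier V) {f :: nat \<Rightarrow> complex. \<forall>i\<ge>n. f i = 0}"
    and add: "\<And>x y i. x \<in> carrier V \<Longrightarrow> y \<in> carrier V \<Longrightarrow> \<Phi> (x \<oplus>\<^bsub>V\<^esub> y) i = \<Phi> x i + \<Phi> y i"
    and smult: "\<And>z x i. x \<in> carrier V \<Longrightarrow> \<Phi> (z \<odot>\<^bsub>V\<^esub> x) i = z * \<Phi> x i"
  shows "vectorspace.fin_dim complex_ring V \<and> vectorspace.dim complex_ring V = n"
proof -
  interpret vectorspace complex_ring V by fact
  define unit where "unit k = (\<lambda>i. if i = k then 1 else 0 :: complex)" for k :: nat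
  define b where "b k = inv_into (carrier V) \<Phi> (unit k)" for k
  have unit: "unit k \<in> \<Phi> ` carrier V" if "k < n" for k
    using bij that by (auto simp: bij_betw_def unit_def)
  have b: "b k \<in> carrier V" "\<Phi> (b k) = unit k" if "k < n" for k
    using unit[OF that] by (simp_all add: b_def inv_into_into f_inv_into_f)
  have inj: "inj_on b {..<n}"
  proof (rule inj_onI)
    fix k l assume "k \<in> {..<n}" "l \<in> {..<n}" "b k = b l"
    then have "unit k k = unit l k" using b by (metis lessThan_iff)
    then show "k = l" by (simp add: unit_def split: if_splits)
  qed
  let ?B = "b ` {..<n}"
  have B: "?B \<subseteq> carrier V" using b by auto
  have \<Phi>_0: "\<Phi> \<zero>\<^bsub>V\<^esub> i = 0" for i
    using add[of "\<zero>\<^bsub>V\<^esub>" "\<zero>\<^bsub>V\<^esub>" i] by simp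
  have \<Phi>_lincomb: "\<Phi> (lincomb a A) i = (\<Sum>v\<in>A. a v * \<Phi> v i)"
    if "finite A" "A \<subseteq> carrier V" for a A i
    using that
  proof (induction A rule: finite_induct)
    case empty
    then show ?case by (simp add: lincomb_def \<Phi>_0)
  next
    case (insert v A)
    have "lincomb a (insert v A) = a v \<odot>\<^bsub>V\<^esub> v \<oplus>\<^bsub>V\<^esub> lincomb a A"
      using insert lincomb_insert[of A a v] by (simp add: complex_ring_simps)
    moreover have "a v \<odot>\<^bsub>V\<^esub> v \<in> carrier V" "lincomb a A \<in> carrier V"
      using insert by (auto intro!: lincomb_closed smult_closed simp: complex_ring_simps)
    ultimately show ?case using insert by (simp add: add smult)
  qed
  have \<Phi>_B: "\<Phi> (lincomb a ?B) i = (if i < n then a (b i) else 0)" for a i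
  proof -
    have "\<Phi> (lincomb a ?B) i = (\<Sum>k<n. a (b k) * unit k i)"
      using inj b B by (simp add: \<Phi>_lincomb sum.reindex)
    then show ?thesis by (simp add: unit_def if_distrib[of "\<lambda>z. _ * z"] cong: if_cong)
  qed
  have "lin_indpt ?B"
  proof
    assume "lin_dep ?B"
    then obtain a v where a: "lincomb a ?B = \<zero>\<^bsub>V\<^esub>" "v \<in> ?B" "a v \<noteq> 0"
      using finite_lin_dep[OF _ _ B] by (auto simp: complex_ring_simps)
    then obtain k where k: "k < n" "v = b k" by auto
    then have "a v = 0" using \<Phi>_B[of a k] a(1) by (simp add: \<Phi>_0)
    with a show False by simp
  qed
  moreover have "span ?B = carrier V"
  proof
    show "span ?B \<subseteq> carrier V" using B by (rule span_is_subset2)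
    show "carrier V \<subseteq> span ?B"
    proof
      fix x assume x: "x \<in> carrier V"
      define a where "a v = \<Phi> x (inv_into {..<n} b v)" for v
      have "\<Phi> x i = 0" if "i \<ge> n" for i
        using bij_betwE[OF bij] x that by auto
      then have "\<Phi> (lincomb a ?B) = \<Phi> x"
        using inj unfolding fun_eq_iff \<Phi>_B by (auto simp: a_def)
      moreover have "lincomb a ?B \<in> carrier V"
        using B by (auto intro!: lincomb_closed simp: complex_ring_simps)
      ultimately have "x = lincomb a ?B"
        using bij x by (auto simp: bij_betw_def dest: inj_onD)
      then show "x \<in> span ?B"
        unfolding span_def using finite_imageI[of "{..<n}" b]
        by (auto simp: complex_ring_simps intro!: exI[of _ a] exI[of _ ?B])
    qed
  qed
  ultimately have basis: "basis ?B" using B by (simp add: basis_def)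
  then have "dim = n" using dim_basis[of ?B] inj by (simp add: card_image)
  moreover have fin_dim unfolding fin_dim_def using basis
    by (intro exI[of _ ?B]) (simp add: basis_def)
  ultimately show ?thesis by simp
qed

lemma (in vectorspace) dim_1_spanned:
  assumes "fin_dim" "dim = 1" "v \<in> carrier V" "v \<noteq> \<zero>\<^bsub>V\<^esub>" "x \<in> carrier V"
  shows "\<exists>z\<in>carrier K. x = z \<odot>\<^bsub>V\<^esub> v"
proof -
  have "lin_indpt {v}"
    using assms(3,4) by (metis empty_iff empty_subsetI finite.emptyI finite_lin_indpt2 insert_iff insert_subset
        insert_union lin_dep_iff_in_span span_empty singletonD)
  then have "basis {v}" using assms by (intro dim_li_is_basis) auto
  then have "x \<in> span {v}" using assms(5) by (simp add: basis_def)
  then obtain a where "a \<in> {v} \<rightarrow> carrier K" "lincomb a {v} = x"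
    using finite_in_span[of "{v}" x] assms(3) by auto
  moreover from this have "lincomb a {v} = a v \<odot>\<^bsub>V\<^esub> v"
    using assms(3) by (auto simp: lincomb_def)
  ultimately show ?thesis by auto
qed

section \<open>Extension of scalars\<close>

locale scalar_extension =
  fixes R :: "('a, 'b) ring_scheme" and S :: "'a set" and V :: "('a, 'c, 'd) module_scheme"
  assumes ring_R: "ring R" and subring_S: "subring S R" and module_V: "left_module (R\<lparr>carrier := S\<rparr>) V"
begin

abbreviation (input) ext where "ext \<equiv> induced_module R S V"
abbreviation (input) pairs where "pairs \<equiv> tensor_free R V"
abbreviation (input) kern where "kern \<equiv> tensor_kernel R S V"

lemma left_module_ext: "left_module R ext"
  by (rule left_module_induced[OF ring_R subring_S module_V])

definition coset :: "('a \<times> 'c \<Rightarrow>\<^sub>0 int) \<Rightarrow> ('a \<times> 'c \<Rightarrow>\<^sub>0 int) set" where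
  "coset x = kern #>\<^bsub>pairs\<^esub> x"

definition tensor :: "'a \<Rightarrow> 'c \<Rightarrow> ('a \<times> 'c \<Rightarrow>\<^sub>0 int) set" where
  "tensor a v = coset (frag_of (a, v))"

lemma S_subset: "S \<subseteq> carrier R" using subringE(1)[OF subring_S] .

lemma V_closed:
  "s \<in> S \<Longrightarrow> v \<in> carrier V \<Longrightarrow> s \<odot>\<^bsub>V\<^esub> v \<in> carrier V"
  "v \<in> carrier V \<Longrightarrow> w \<in> carrier V \<Longrightarrow> v \<oplus>\<^bsub>V\<^esub> w \<in> carrier V"
  using left_module.smult_closed[OF module_V] module_V unfolding left_module_def
  by (simp_all add: abelian_monoid.a_closed abelian_group_def)

lemma relations_subset: "tensor_relations R S V \<subseteq> carrier pairs"
proof -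
  interpret R: ring R by (rule ring_R)
  have diff: "x - y \<in> carrier pairs" if "x \<in> carrier pairs" "y \<in> carrier pairs" for x y
    using that keys_diff[of x y] by auto
  have "frag_of p \<in> carrier pairs" if "p \<in> carrier R \<times> carrier V" for p
    using that by simp
  then show ?thesis
    unfolding tensor_relations_def using S_subset V_closed
    by (auto simp del: frag_of_in_free_Abelian_group carrier_free_Abelian_group_iff intro!: diff)
qed

lemma subgroup_kern: "subgroup kern pairs"
  unfolding tensor_kernel_def
  by (rule group.generate_is_subgroup[OF group_free_Abelian_group relations_subset])

lemma relations_kern: "x \<in> tensor_relations R S V \<Longrightarrow> x \<in> kern"
  unfolding tensor_kernel_def by (rule generate.incl)

lemma normal_kern: "kern \<lhd> pairs"
  by (rule comm_group.subgroup_imp_normal[OF _ subgroup_kern])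
    (rule abelian_free_Abelian_group)

lemma carrier_ext: "carrier ext = coset ` carrier pairs"
  by (auto simp: induced_module_def Let_def FactGroup_def RCOSETS_def coset_def)

lemma coset_add:
  "x \<in> carrier pairs \<Longrightarrow> y \<in> carrier pairs \<Longrightarrow> coset x \<oplus>\<^bsub>ext\<^esub> coset y = coset (x + y)"
  using normal.rcos_sum[OF normal_kern, of x y]
  by (simp add: induced_module_def Let_def coset_def)

lemma coset_self: "x \<in> carrier pairs \<Longrightarrow> x \<in> coset x"
  unfolding coset_def by (rule group.rcos_self[OF group_free_Abelian_group _ subgroup_kern])

lemma coset_memberD: "x \<in> carrier pairs \<Longrightarrow> y \<in> coset x \<Longrightarrow> coset y = coset x"
  unfolding coset_def
  by (metis group.repr_independence[OF group_free_Abelian_group] subgroup_kern)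

lemma coset_eqI:
  assumes "x \<in> carrier pairs" "y \<in> carrier pairs" "x - y \<in> kern"
  shows "coset x = coset y"
proof -
  have "x \<in> coset y"
    using assms(3) by (force simp: coset_def r_coset_def)
  then show ?thesis using coset_memberD[OF assms(2)] by simp
qed

lemma zero_ext: "\<zero>\<^bsub>ext\<^esub> = coset 0"
  using subgroup.subset[OF subgroup_kern]
  by (auto simp: induced_module_def Let_def coset_def r_coset_def FactGroup_def)

text \<open>The definition takes a union of cosets. The scalar multiple is known to be a single coset from
  \<open>left_module_induced\<close>, hence it is the coset of any of its members.\<close>

lemma smult_coset:
  assumes "r \<in> carrier R" "x \<in> carrier pairs"
  shows "r \<odot>\<^bsub>ext\<^esub> coset x = coset (frag_extend (\<lambda>(a, v). frag_of (r \<otimes>\<^bsub>R\<^esub> a, v)) x)"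
    (is "_ = coset ?y")
proof -
  have "r \<odot>\<^bsub>ext\<^esub> coset x
      = (\<Union>c\<in>coset x. coset (frag_extend (\<lambda>(a, v). frag_of (r \<otimes>\<^bsub>R\<^esub> a, v)) c))"
    by (simp add: induced_module_def Let_def coset_def)
  moreover have "?y \<in> carrier pairs"
  proof -
    interpret R: ring R by (rule ring_R)
    have "Poly_Mapping.keys ?y \<subseteq> (\<Union>p\<in>Poly_Mapping.keys x. Poly_Mapping.keys (case p of (a, v) \<Rightarrow> frag_of (r \<otimes>\<^bsub>R\<^esub> a, v)))"
      by (rule keys_frag_extend)
    also have "\<dots> \<subseteq> carrier R \<times> carrier V" using assms by (force split: prod.splits)
    finally show ?thesis by simp
  qed
  ultimately have y: "?y \<in> r \<odot>\<^bsub>ext\<^esub> coset x"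
    using coset_self assms(2) by blast
  have "r \<odot>\<^bsub>ext\<^esub> coset x \<in> carrier ext"
    using left_module.smult_closed[OF left_module_ext] assms by (simp add: carrier_ext)
  then obtain z where "z \<in> carrier pairs" "r \<odot>\<^bsub>ext\<^esub> coset x = coset z"
    by (auto simp: carrier_ext)
  with y show ?thesis using coset_memberD by simp
qed

lemma tensor_closed: "a \<in> carrier R \<Longrightarrow> v \<in> carrier V \<Longrightarrow> tensor a v \<in> carrier ext"
  by (simp add: tensor_def carrier_ext)

lemma smult_tensor:
  "r \<in> carrier R \<Longrightarrow> a \<in> carrier R \<Longrightarrow> v \<in> carrier V \<Longrightarrow>
    r \<odot>\<^bsub>ext\<^esub> tensor a v = tensor (r \<otimes>\<^bsub>R\<^esub> a) v"
  by (simp add: tensor_def smult_coset)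

lemma tensor_balanced:
  assumes "a \<in> carrier R" "s \<in> S" "v \<in> carrier V"
  shows "tensor (a \<otimes>\<^bsub>R\<^esub> s) v = tensor a (s \<odot>\<^bsub>V\<^esub> v)"
proof -
  interpret R: ring R by (rule ring_R)
  have "frag_of (a \<otimes>\<^bsub>R\<^esub> s, v) - frag_of (a, s \<odot>\<^bsub>V\<^esub> v) \<in> kern"
    using assms by (intro relations_kern) (auto simp: tensor_relations_def)
  then show ?thesis unfolding tensor_def
    using assms S_subset V_closed by (intro coset_eqI) auto
qed

text \<open>The tensors generate the extension as a group, so negatives have to be covered as well as sums.\<close>

lemma ext_induct:
  assumes "m \<in> carrier ext"
    and "\<zero>\<^bsub>ext\<^esub> \<in> H"
    and "\<And>x y. x \<in> H \<Longrightarrow> y \<in> H \<Longrightarrow> x \<oplus>\<^bsub>ext\<^esub> y \<in> H"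
    and "\<And>x. x \<in> H \<Longrightarrow> \<ominus>\<^bsub>ext\<^esub> x \<in> H"
    and "\<And>a v. a \<in> carrier R \<Longrightarrow> v \<in> carrier V \<Longrightarrow> tensor a v \<in> H"
  shows "m \<in> H"
proof -
  interpret M: left_module R ext by (rule left_module_ext)
  have "coset x \<in> H \<and> x \<in> carrier pairs" if "Poly_Mapping.keys x \<subseteq> carrier R \<times> carrier V" for x
    using that
  proof (induction x rule: frag_induction)
    case zero
    then show ?case using assms(2) by (simp add: zero_ext)
  next
    case (one p)
    then show ?case using assms(5) by (cases p) (simp add: tensor_def)
  next
    case (diff x y)
    have xy: "x - y \<in> carrier pairs"
      using diff keys_diff[of x y] by auto
    have mem: "coset x \<in> carrier ext" "coset y \<in> carrier ext" "coset (x - y) \<in> carrier ext"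
      using diff xy by (auto simp: carrier_ext)
    have "coset (x - y) \<oplus>\<^bsub>ext\<^esub> coset y = coset x" using diff xy by (simp add: coset_add)
    then have "coset (x - y) = coset x \<oplus>\<^bsub>ext\<^esub> \<ominus>\<^bsub>ext\<^esub> coset y"
      using mem by (metis M.a_assoc M.a_inv_closed M.r_neg M.r_zero)
    then show ?case using diff assms(3,4) xy by simp
  qed
  then show ?thesis using assms(1) by (auto simp: carrier_ext)
qed

end

text \<open>The universal property of the tensor product, for values in a complex vector space.\<close>

locale balanced_map = scalar_extension R S V + vector_space scale
  for R :: "('a, 'b) ring_scheme" and S and V :: "('a, 'c, 'd) module_scheme"
    and scale :: "complex \<Rightarrow> 'e::ab_group_add \<Rightarrow> 'e" +
  fixes \<beta> :: "'a \<Rightarrow> 'c \<Rightarrow> 'e"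
  assumes add_left: "\<lbrakk>a \<in> carrier R; b \<in> carrier R; v \<in> carrier V\<rbrakk> \<Longrightarrow> \<beta> (a \<oplus>\<^bsub>R\<^esub> b) v = \<beta> a v + \<beta> b v"
    and add_right: "\<lbrakk>a \<in> carrier R; v \<in> carrier V; w \<in> carrier V\<rbrakk> \<Longrightarrow> \<beta> a (v \<oplus>\<^bsub>V\<^esub> w) = \<beta> a v + \<beta> a w"
    and balanced: "\<lbrakk>a \<in> carrier R; s \<in> S; v \<in> carrier V\<rbrakk> \<Longrightarrow> \<beta> (a \<otimes>\<^bsub>R\<^esub> s) v = \<beta> a (s \<odot>\<^bsub>V\<^esub> v)"
begin

definition frag_val :: "('a \<times> 'c \<Rightarrow>\<^sub>0 int) \<Rightarrow> 'e" where
  "frag_val x = (\<Sum>p\<in>Poly_Mapping.keys x. scale (of_int (Poly_Mapping.lookup x p)) (\<beta> (fst p) (snd p)))"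

definition induced_map :: "('a \<times> 'c \<Rightarrow>\<^sub>0 int) set \<Rightarrow> 'e" where
  "induced_map C = the_elem (frag_val ` C)"

lemma frag_val_of: "frag_val (frag_of (a, v)) = \<beta> a v"
  by (simp add: frag_val_def)

lemma frag_val_0: "frag_val 0 = 0"
  by (simp add: frag_val_def)

lemma frag_val_superset:
  assumes "finite A" "Poly_Mapping.keys x \<subseteq> A"
  shows "frag_val x = (\<Sum>p\<in>A. scale (of_int (Poly_Mapping.lookup x p)) (\<beta> (fst p) (snd p)))"
  unfolding frag_val_def using assms by (intro sum.mono_neutral_left) (auto simp: in_keys_iff)

lemma frag_val_add: "frag_val (x + y) = frag_val x + frag_val y"
proof -
  let ?A = "Poly_Mapping.keys x \<union> Poly_Mapping.keys y"
  have "frag_val (x + y) = (\<Sum>p\<in>?A. scale (of_int (Poly_Mapping.lookup (x + y) p)) (\<beta> (fst p) (snd p)))"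
    using keys_add[of x y] by (intro frag_val_superset) auto
  then show ?thesis
    by (simp add: frag_val_superset[of ?A] lookup_add scale_left_distrib sum.distrib)
qed

lemma frag_val_diff: "frag_val (x - y) = frag_val x - frag_val y"
  using frag_val_add[of "x - y" y] by simp

lemma frag_val_kern:
  assumes "x \<in> kern" shows "frag_val x = 0"
  using assms unfolding tensor_kernel_def
proof (induction rule: generate.induct)
  case one
  then show ?case by (simp add: frag_val_0)
next
  case (incl h)
  then show ?case unfolding tensor_relations_def
    by (auto simp: frag_val_diff frag_val_of add_left add_right balanced)
next
  case (inv h)
  then have "frag_val h = 0" unfolding tensor_relations_def
    by (auto simp: frag_val_diff frag_val_of add_left add_right balanced)
  moreover have "h \<in> carrier pairs" using inv relations_subset by blast
  ultimately show ?case using frag_val_diff[of 0 h] by (simp add: frag_val_0)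
next
  case (eng h1 h2)
  then show ?case by (simp add: frag_val_add)
qed

lemma induced_map_coset: "x \<in> carrier pairs \<Longrightarrow> induced_map (coset x) = frag_val x"
proof -
  assume "x \<in> carrier pairs"
  moreover have "frag_val y = frag_val x" if "y \<in> coset x" for y
    using that by (auto simp: coset_def r_coset_def frag_val_add frag_val_kern)
  ultimately have "frag_val ` coset x = {frag_val x}" using coset_self by blast
  then show ?thesis by (simp add: induced_map_def)
qed

lemma induced_map_tensor: "a \<in> carrier R \<Longrightarrow> v \<in> carrier V \<Longrightarrow> induced_map (tensor a v) = \<beta> a v"
  by (simp add: tensor_def induced_map_coset frag_val_of)

lemma induced_map_add:
  "m \<in> carrier ext \<Longrightarrow> m' \<in> carrier ext \<Longrightarrow>
    induced_map (m \<oplus>\<^bsub>ext\<^esub> m') = induced_map m + induced_map m'"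
proof -
  assume "m \<in> carrier ext" "m' \<in> carrier ext"
  then obtain x y where "x \<in> carrier pairs" "m = coset x" "y \<in> carrier pairs" "m' = coset y"
    by (auto simp: carrier_ext)
  moreover from this have "x + y \<in> carrier pairs" using keys_add[of x y] by auto
  ultimately show ?thesis
    by (simp add: coset_add induced_map_coset frag_val_add del: carrier_free_Abelian_group_iff)
qed

end

section \<open>Hecke classes\<close>

lemma hecke_class_ops:
  "hecke_class q f \<oplus>\<^bsub>hecke q\<^esub> hecke_class q g = hecke_class q (f + g)"
  "hecke_class q f \<otimes>\<^bsub>hecke q\<^esub> hecke_class q g = hecke_class q (f * g)"
  "\<one>\<^bsub>hecke q\<^esub> = hecke_class q 1"
  using ring_hom_add[OF ideal.rcos_ring_hom[OF ideal_hecke_ideal[of q]], of f g]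
    ring_hom_mult[OF ideal.rcos_ring_hom[OF ideal_hecke_ideal[of q]], of f g]
    ring_hom_one[OF ideal.rcos_ring_hom[OF ideal_hecke_ideal[of q]]]
  by (simp_all add: hecke_def hecke_class_def ring_of_type_algebra_def)

lemma carrier_hecke: "carrier (hecke q) = range (hecke_class q)"
  by (auto simp: hecke_def hecke_class_def FactRing_def A_RCOSETS_def' ring_of_type_algebra_def)

lemma hecke_class_closed [simp]: "hecke_class q f \<in> carrier (hecke q)"
  by (simp add: carrier_hecke)

lemma hecke_class_eqI:
  assumes "f - g \<in> hecke_relators q"
  shows "hecke_class q f = hecke_class q g"
proof -
  interpret H: ring "hecke q" by (rule ring_hecke)
  interpret F: ring "ring_of_type_algebra :: gen free_alg ring" by (rule ring_free_alg)
  have "f - g \<in> hecke_ideal q"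
    using assms F.genideal_self[of "hecke_relators q"]
    by (auto simp: hecke_ideal_def ring_of_type_algebra_def)
  then have "hecke_class q (f - g) = hecke_ideal q"
    unfolding hecke_class_def
    by (intro F.a_coset_join2 additive_subgroup.a_subgroup ideal.axioms(1)[OF ideal_hecke_ideal])
      (simp_all add: ring_of_type_algebra_def)
  also have "hecke_ideal q = \<zero>\<^bsub>hecke q\<^esub>" by (simp add: hecke_def FactRing_def)
  finally have "hecke_class q (f - g) \<oplus>\<^bsub>hecke q\<^esub> hecke_class q g = hecke_class q g" by simp
  then show ?thesis by (simp add: hecke_class_ops)
qed

lemma hecke_relations:
  "hecke_class q (fX 0) = hecke_class q 1"
  "hecke_class q (fX l * fX m) = hecke_class q (fX (l + m))"
  "hecke_class q (fT i * fT i) = hecke_class q (free_scalar (q - inverse q) * fT i + 1)"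
  "hecke_class q (fT N1 * fT N2 * fT N1 * fT N2 * fT N1 * fT N2) =
   hecke_class q (fT N2 * fT N1 * fT N2 * fT N1 * fT N2 * fT N1)"
  "bernstein_quotient i l f \<Longrightarrow> hecke_class q (fX l * fT i) =
   hecke_class q (fT i * fX (simple_refl i l) + free_scalar (q - inverse q) * group_alg_lift f)"
  by (rule hecke_class_eqI; unfold hecke_relators_def; blast)+

lemma free_scalar_central: "free_scalar z * f = f * free_scalar z"
proof (induction f rule: poly_mapping_add_induct)
  case (single k c)
  then show ?case by (simp add: free_scalar_def mult_single mult.commute)
qed (simp_all add: distrib_left distrib_right)

lemma free_scalar_ops:
  "free_scalar (z + w) = free_scalar z + free_scalar w"
  "free_scalar (z * w) = free_scalar z * free_scalar w"
  "free_scalar 1 = 1" "free_scalar 0 = 0"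
  by (simp_all add: free_scalar_def mult_single single_add)

text \<open>With additivity below, this replaces the sum over the support in inductions on the group algebra.\<close>

lemma group_alg_lift_single: "group_alg_lift (Poly_Mapping.single l z) = free_scalar z * fX l"
  by (simp add: group_alg_lift_def free_scalar_ops)

lemma group_alg_lift_add: "group_alg_lift (f + g) = group_alg_lift f + group_alg_lift g"
proof -
  have sup: "group_alg_lift f = (\<Sum>l\<in>A. free_scalar (Poly_Mapping.lookup f l) * fX l)"
    if "finite A" "Poly_Mapping.keys f \<subseteq> A" for f A
    unfolding group_alg_lift_def using that
    by (intro sum.mono_neutral_left) (auto simp: in_keys_iff free_scalar_ops)
  let ?A = "Poly_Mapping.keys f \<union> Poly_Mapping.keys g"
  have "group_alg_lift (f + g) = (\<Sum>l\<in>?A. free_scalar (Poly_Mapping.lookup (f + g) l) * fX l)"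
    using keys_add[of f g] by (intro sup) auto
  then show ?thesis
    by (simp add: sup[of ?A] lookup_add free_scalar_ops distrib_right sum.distrib)
qed

lemma parabolic_subring: "subring (hecke_parabolic q i) (hecke q)"
  unfolding hecke_parabolic_def
  by (rule ring.generate_ring_is_subring[OF ring_hecke]) (auto simp: carrier_hecke)

lemma parabolic_gens:
  "hT q i \<in> hecke_parabolic q i" "hecke_class q (group_alg_lift f) \<in> hecke_parabolic q i"
  "hX q l \<in> hecke_parabolic q i" "hscalar q z \<in> hecke_parabolic q i"
proof -
  show 1: "hT q i \<in> hecke_parabolic q i" "hecke_class q (group_alg_lift f) \<in> hecke_parabolic q i" for f
    by (auto simp: hecke_parabolic_def intro: generate_ring.incl)
  show "hX q l \<in> hecke_parabolic q i"
    using 1(2)[of "gX l"] by (simp add: group_alg_lift_single free_scalar_ops)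
  \<comment> \<open>A scalar is a multiple of \<open>X\<^sup>0 = 1\<close>.\<close>
  have "hecke_class q (free_scalar z * fX 0) = hscalar q z"
    using hecke_class_ops(2)[of q "free_scalar z" "fX 0"] hecke_class_ops(2)[of q "free_scalar z" 1]
    by (simp add: hecke_relations)
  then show "hscalar q z \<in> hecke_parabolic q i"
    using 1(2)[of "Poly_Mapping.single 0 z"] by (simp add: group_alg_lift_single)
qed

section \<open>Modules over the Hecke algebra\<close>

locale hecke_module = M: left_module "hecke q" M
  for q :: complex and M :: "(gen free_alg set, 'm, 'n) module_scheme" (structure)
begin

abbreviation app :: "gen free_alg \<Rightarrow> 'm \<Rightarrow> 'm" where "app f m \<equiv> hecke_class q f \<odot>\<^bsub>M\<^esub> m"

lemma app_closed [simp]: "m \<in> carrier M \<Longrightarrow> app f m \<in> carrier M"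
  by (simp add: M.smult_closed)

lemma app_add: "m \<in> carrier M \<Longrightarrow> app (f + g) m = app f m \<oplus> app g m"
  by (simp add: M.smult_l_distr flip: hecke_class_ops)

lemma app_mult: "m \<in> carrier M \<Longrightarrow> app (f * g) m = app f (app g m)"
  by (simp add: M.smult_assoc1 flip: hecke_class_ops)

lemma app_1: "m \<in> carrier M \<Longrightarrow> app 1 m = m"
  by (simp add: M.smult_one flip: hecke_class_ops)

lemma app_vadd: "m \<in> carrier M \<Longrightarrow> m' \<in> carrier M \<Longrightarrow> app f (m \<oplus> m') = app f m \<oplus> app f m'"
  by (simp add: M.smult_r_distr)

lemma app_0: "m \<in> carrier M \<Longrightarrow> app 0 m = \<zero>"
proof -
  assume m: "m \<in> carrier M"
  then have "app 0 m \<oplus> app 0 m = app 0 m" using app_add[of m 0 0] by simp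
  then show ?thesis using m by simp
qed

lemma app_v0 [simp]: "app f \<zero> = \<zero>"
proof -
  have "app f \<zero> \<oplus> app f \<zero> = app f \<zero>" using app_vadd[of \<zero> \<zero> f] by simp
  then show ?thesis by simp
qed

lemma app_minus_1: "m \<in> carrier M \<Longrightarrow> \<ominus> m = app (free_scalar (- 1)) m"
proof -
  assume m: "m \<in> carrier M"
  have "free_scalar (- 1) + 1 = (0 :: gen free_alg)"
    using free_scalar_ops(1)[of "- 1" 1] by (simp add: free_scalar_ops)
  then have "app (free_scalar (- 1)) m \<oplus> m = \<zero>"
    using app_add[OF m, of "free_scalar (- 1)" 1] m by (simp add: app_1 app_0)
  then show ?thesis using m by (simp add: M.minus_equality)
qed

lemma app_scalar_central: "m \<in> carrier M \<Longrightarrow> app f (app (free_scalar z) m) = app (free_scalar z) (app f m)"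
  by (simp add: free_scalar_central flip: app_mult)

lemma vectorspace_complex_space: "vectorspace complex_ring (complex_space q M)"
proof -
  have "abelian_group (complex_space q M)"
    by (rule abelian_groupI) (auto simp: complex_space_def M.a_ac intro!: bexI[where x = "\<ominus> _"] M.l_neg)
  then have "Module.module complex_ring (complex_space q M)"
    by (intro moduleI cring_from_type_algebra)
      (auto simp: complex_space_def complex_ring_simps app_vadd app_add app_mult app_1 free_scalar_ops)
  then show ?thesis by (intro vectorspace.intro field_from_type_algebra)
qed

lemma submodule_closed:
  assumes "Module.submodule N (hecke q) M"
  shows "N \<subseteq> carrier M" "\<zero> \<in> N" "\<And>m m'. m \<in> N \<Longrightarrow> m' \<in> N \<Longrightarrow> m \<oplus> m' \<in> N" "\<And>m. m \<in> N \<Longrightarrow> app f m \<in> N"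
proof -
  interpret N: Module.submodule N "hecke q" M by fact
  show "N \<subseteq> carrier M" "\<zero> \<in> N" "\<And>m m'. m \<in> N \<Longrightarrow> m' \<in> N \<Longrightarrow> m \<oplus> m' \<in> N" "\<And>m. m \<in> N \<Longrightarrow> app f m \<in> N"
    using N.subset N.one_closed N.m_closed by auto
qed

lemma submoduleI:
  assumes "N \<subseteq> carrier M" "\<zero> \<in> N" "\<And>m m'. m \<in> N \<Longrightarrow> m' \<in> N \<Longrightarrow> m \<oplus> m' \<in> N" "\<And>f m. m \<in> N \<Longrightarrow> app f m \<in> N"
  shows "Module.submodule N (hecke q) M"
proof (intro Module.submodule.intro subgroup.intro Module.submodule_axioms.intro)
  fix m assume m: "m \<in> N"
  then have "inv\<^bsub>add_monoid M\<^esub> m = app (free_scalar (- 1)) m"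
    using assms(1) app_minus_1 unfolding a_inv_def by blast
  then show "inv\<^bsub>add_monoid M\<^esub> m \<in> N" using assms(4) m by simp
qed (use assms in \<open>auto simp: carrier_hecke\<close>)

lemma vectorspace_submodule:
  assumes "Module.submodule N (hecke q) M"
  shows "vectorspace complex_ring ((complex_space q M)\<lparr>carrier := N\<rparr>)"
proof -
  interpret V: vectorspace complex_ring "complex_space q M" by (rule vectorspace_complex_space)
  have "\<ominus>\<^bsub>complex_space q M\<^esub> m \<in> N" if "m \<in> N" for m
  proof -
    have m: "m \<in> carrier M" using that submodule_closed(1)[OF assms] by blast
    have "app (free_scalar (- 1)) m \<oplus> m = \<zero>" using m by (simp add: M.l_neg flip: app_minus_1)
    then have "\<ominus>\<^bsub>complex_space q M\<^esub> m = app (free_scalar (- 1)) m"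
      using m by (intro V.minus_equality) (simp_all add: complex_space_def)
    then show ?thesis using submodule_closed(4)[OF assms that] by simp
  qed
  then have "Module.submodule N complex_ring (complex_space q M)"
    using submodule_closed[OF assms] by (intro V.submoduleI) (auto simp: complex_space_def)
  then have "Module.module complex_ring ((complex_space q M)\<lparr>carrier := N\<rparr>)"
    by (rule Module.submodule.submodule_is_module) (rule V.module_axioms)
  then show ?thesis by (intro vectorspace.intro field_from_type_algebra)
qed

text \<open>The Bernstein relation moves \<open>X\<^sup>\<lambda>\<close> past \<open>T\<^sub>i\<close> at the cost of further torus elements. So a subspace
  stable under \<open>T\<^sub>i\<close> absorbs the torus orbit of \<open>T\<^sub>i m\<close> once it absorbs that of \<open>m\<close>.\<close>

lemma torus_preserved:
  assumes W: "W \<subseteq> carrier M" "\<And>m m'. m \<in> W \<Longrightarrow> m' \<in> W \<Longrightarrow> m \<oplus> m' \<in> W" "\<zero> \<in> W"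
      "\<And>z m. m \<in> W \<Longrightarrow> app (free_scalar z) m \<in> W" "\<And>m. m \<in> W \<Longrightarrow> app (fT i) m \<in> W"
    and m: "m \<in> W" "\<And>l. app (fX l) m \<in> W"
  shows "app (fX l) (app (fT i) m) \<in> W"
proof -
  obtain f where f: "bernstein_quotient i l f" using bernstein_quotient_ex1 by blast
  have mc: "m \<in> carrier M" using m(1) W(1) by blast
  have lift: "app (group_alg_lift f) m \<in> W" for f
  proof (induction f rule: poly_mapping_add_induct)
    case zero
    then show ?case using mc W(3) by (simp add: group_alg_lift_def app_0)
  next
    case (single l c)
    then show ?case using mc W(4) m(2) by (simp add: group_alg_lift_single app_mult)
  next
    case (add f g)
    then show ?case using mc W(2) by (simp add: group_alg_lift_add app_add)
  qed
  have "app (fX l) (app (fT i) m)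
      = app (fT i) (app (fX (simple_refl i l)) m) \<oplus> app (free_scalar (q - inverse q)) (app (group_alg_lift f) m)"
    using mc by (simp add: hecke_relations(5)[OF f] app_add app_mult flip: app_mult[of m "fX l" "fT i"])
  then show ?thesis using W m lift by simp
qed

primrec comb :: "(nat \<Rightarrow> 'm) \<Rightarrow> (nat \<Rightarrow> complex) \<Rightarrow> nat \<Rightarrow> 'm" where
  "comb u c 0 = \<zero>"
| "comb u c (Suc n) = comb u c n \<oplus> app (free_scalar (c n)) (u n)"

definition combs :: "(nat \<Rightarrow> 'm) \<Rightarrow> nat \<Rightarrow> 'm set" where
  "combs u n = range (\<lambda>c. comb u c n)"

context
  fixes u :: "nat \<Rightarrow> 'm"
  assumes u: "\<And>k. u k \<in> carrier M"
begin

lemma comb_closed [simp]: "comb u c n \<in> carrier M"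
  by (induction n) (simp_all add: u)

lemma comb_add: "comb u (\<lambda>k. c k + d k) n = comb u c n \<oplus> comb u d n"
  by (induction n) (simp_all add: u free_scalar_ops app_add M.a_ac)

lemma comb_scale: "comb u (\<lambda>k. z * c k) n = app (free_scalar z) (comb u c n)"
  by (induction n) (simp_all add: u free_scalar_ops app_vadd app_mult)

lemma comb_unit: "comb u (\<lambda>k. if k = j then 1 else 0) n = (if j < n then u j else \<zero>)"
  by (induction n) (auto simp: u free_scalar_ops app_1 app_0 less_Suc_eq)

lemma combs_closed:
  "combs u n \<subseteq> carrier M" "\<zero> \<in> combs u n"
  "m \<in> combs u n \<Longrightarrow> m' \<in> combs u n \<Longrightarrow> m \<oplus> m' \<in> combs u n"
  "m \<in> combs u n \<Longrightarrow> app (free_scalar z) m \<in> combs u n"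
  "k < n \<Longrightarrow> u k \<in> combs u n"
proof -
  show "combs u n \<subseteq> carrier M" by (auto simp: combs_def)
  show "\<zero> \<in> combs u n" using comb_unit[of n n] by (auto simp: combs_def image_iff) (metis less_irrefl)
  show "m \<in> combs u n \<Longrightarrow> m' \<in> combs u n \<Longrightarrow> m \<oplus> m' \<in> combs u n"
    by (auto simp: combs_def simp flip: comb_add)
  show "m \<in> combs u n \<Longrightarrow> app (free_scalar z) m \<in> combs u n"
    by (auto simp: combs_def simp flip: comb_scale)
  show "k < n \<Longrightarrow> u k \<in> combs u n"
    unfolding combs_def by (rule range_eqI[of _ _ "\<lambda>j. if j = k then 1 else 0"]) (simp add: comb_unit)
qed

lemma app_combs:
  assumes "\<And>k. k < n \<Longrightarrow> app f (u k) \<in> combs u n" and "m \<in> combs u n"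
  shows "app f m \<in> combs u n"
proof -
  have "app f (comb u c j) \<in> combs u n" if "j \<le> n" for c j
    using that
  proof (induction j)
    case (Suc j)
    then show ?case
      by (simp add: u app_vadd app_scalar_central combs_closed assms(1))
  qed (simp add: combs_closed)
  then show ?thesis using assms(2) by (auto simp: combs_def)
qed

end

lemma combs_all:
  assumes u: "\<And>k. u k \<in> carrier M"
    and T: "\<And>k i. k < n \<Longrightarrow> app (fT i) (u k) \<in> combs u n"
    and X: "\<And>k l. k < n \<Longrightarrow> app (fX l) (u k) \<in> combs u n"
    and m: "m \<in> combs u n"
  shows "app f m \<in> combs u n"
proof -
  note C = combs_closed[of u, OF u]
  have mc: "m \<in> carrier M" using m C(1) by blast
  show ?thesis
  proof (induction f rule: poly_mapping_add_induct)
    case zero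
    then show ?case using mc by (simp add: app_0 C)
  next
    case (single k c)
    obtain gs where k: "k = Word gs" by (cases k)
    have mem: "app (Poly_Mapping.single (Word gs) 1) m \<in> combs u n"
    proof (induction gs)
      case Nil
      then show ?case using m mc by (simp add: app_1 flip: zero_free_mon_def)
    next
      case (Cons g gs)
      have "Poly_Mapping.single (Word (g # gs)) 1 = free_gen g * Poly_Mapping.single (Word gs) (1::complex)"
        by (simp add: free_gen_def mult_single)
      moreover have "app (free_gen g) m' \<in> combs u n" if "m' \<in> combs u n" for m'
        by (cases g; rule app_combs[of u, OF u _ that]; simp add: T X)
      ultimately show ?case using Cons mc by (simp add: app_mult)
    qed
    have "Poly_Mapping.single k c = free_scalar c * Poly_Mapping.single k 1"
      by (simp add: free_scalar_def mult_single)
    then show ?case using mem mc by (simp add: app_mult k C)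
  next
    case (add f g)
    then show ?case using mc by (simp add: app_add C)
  qed
qed

end

lemma hecke_a_inv: "\<ominus>\<^bsub>hecke q\<^esub> hecke_class q f = hecke_class q (- f)"
proof -
  interpret H: ring "hecke q" by (rule ring_hecke)
  have "hecke_class q (- f) \<oplus>\<^bsub>hecke q\<^esub> hecke_class q f = \<zero>\<^bsub>hecke q\<^esub>"
    using H.l_zero[of "hecke_class q 0"] H.add.l_cancel_one[of "hecke_class q 0" "hecke_class q 0"]
    by (simp add: hecke_class_ops)
  then show ?thesis by (intro H.minus_equality) simp_all
qed

section \<open>Induction from a one-dimensional module\<close>

text \<open>A vector \<open>base\<close> of a representation on which \<open>T\<^sub>i\<close> and the torus act as on the generator \<open>v\<close> of a
  one-dimensional module determines an equivariant map from the induced module, by Frobenius reciprocity.\<close>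

locale character_induction = hecke_rep scale q T Y
  for scale :: "complex \<Rightarrow> 'e::ab_group_add \<Rightarrow> 'e" (infixr \<open>*s\<close> 75) and q T Y +
  fixes i :: node and V :: "(gen free_alg set, 'v) module" and v :: 'v and c :: complex
    and t :: "wlat \<Rightarrow> complex" and base :: 'e
  assumes one_dim: "one_dim_module q i V v c t"
    and T_base: "T i base = c *s base"
    and Y_base: "Y l base = t l *s base"
begin

abbreviation S :: "gen free_alg set set" where "S \<equiv> hecke_parabolic q i"

lemma module_V: "left_module ((hecke q)\<lparr>carrier := S\<rparr>) V"
  using one_dim by (simp add: one_dim_module_def)

sublocale V: left_module "(hecke q)\<lparr>carrier := S\<rparr>" V by (rule module_V)

sublocale scalar_extension "hecke q" S V
  by (intro scalar_extension.intro ring_hecke parabolic_subring module_V)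

sublocale M: hecke_module q "induced_module (hecke q) S V"
  by (intro hecke_module.intro left_module_ext)

lemma v: "v \<in> carrier V" "v \<noteq> \<zero>\<^bsub>V\<^esub>" "hT q i \<odot>\<^bsub>V\<^esub> v = hscalar q c \<odot>\<^bsub>V\<^esub> v"
  "hX q l \<odot>\<^bsub>V\<^esub> v = hscalar q (t l) \<odot>\<^bsub>V\<^esub> v"
  using one_dim by (simp_all add: one_dim_module_def del: split_paired_All)

lemma S_carrier: "s \<in> S \<Longrightarrow> \<exists>f. s = hecke_class q f"
  using S_subset by (auto simp: carrier_hecke)

lemma V_smult:
  assumes "x \<in> carrier V"
  shows "s \<in> S \<Longrightarrow> s' \<in> S \<Longrightarrow> (s \<oplus>\<^bsub>hecke q\<^esub> s') \<odot>\<^bsub>V\<^esub> x = s \<odot>\<^bsub>V\<^esub> x \<oplus>\<^bsub>V\<^esub> s' \<odot>\<^bsub>V\<^esub> x"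
    "s \<in> S \<Longrightarrow> s' \<in> S \<Longrightarrow> (s \<otimes>\<^bsub>hecke q\<^esub> s') \<odot>\<^bsub>V\<^esub> x = s \<odot>\<^bsub>V\<^esub> (s' \<odot>\<^bsub>V\<^esub> x)"
    "hecke_class q 1 \<odot>\<^bsub>V\<^esub> x = x"
  using V.smult_l_distr V.smult_assoc1 V.smult_one assms by (simp_all flip: hecke_class_ops(3))

lemma V_scalars:
  assumes "x \<in> carrier V"
  shows "hscalar q (z + w) \<odot>\<^bsub>V\<^esub> x = hscalar q z \<odot>\<^bsub>V\<^esub> x \<oplus>\<^bsub>V\<^esub> hscalar q w \<odot>\<^bsub>V\<^esub> x"
    "hscalar q (z * w) \<odot>\<^bsub>V\<^esub> x = hscalar q z \<odot>\<^bsub>V\<^esub> (hscalar q w \<odot>\<^bsub>V\<^esub> x)"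
    "hscalar q 1 \<odot>\<^bsub>V\<^esub> x = x"
    "s \<in> S \<Longrightarrow> s \<odot>\<^bsub>V\<^esub> (hscalar q z \<odot>\<^bsub>V\<^esub> x) = hscalar q z \<odot>\<^bsub>V\<^esub> (s \<odot>\<^bsub>V\<^esub> x)"
proof -
  show "hscalar q (z + w) \<odot>\<^bsub>V\<^esub> x = hscalar q z \<odot>\<^bsub>V\<^esub> x \<oplus>\<^bsub>V\<^esub> hscalar q w \<odot>\<^bsub>V\<^esub> x"
    "hscalar q (z * w) \<odot>\<^bsub>V\<^esub> x = hscalar q z \<odot>\<^bsub>V\<^esub> (hscalar q w \<odot>\<^bsub>V\<^esub> x)"
    "hscalar q 1 \<odot>\<^bsub>V\<^esub> x = x"
    using V_smult[OF assms] by (simp_all add: free_scalar_ops parabolic_gens flip: hecke_class_ops)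
  assume s: "s \<in> S"
  then obtain f where "s = hecke_class q f" using S_carrier by blast
  then have "s \<otimes>\<^bsub>hecke q\<^esub> hscalar q z = hscalar q z \<otimes>\<^bsub>hecke q\<^esub> s"
    by (simp add: hecke_class_ops free_scalar_central)
  then show "s \<odot>\<^bsub>V\<^esub> (hscalar q z \<odot>\<^bsub>V\<^esub> x) = hscalar q z \<odot>\<^bsub>V\<^esub> (s \<odot>\<^bsub>V\<^esub> x)"
    using V_smult(2)[OF assms] s parabolic_gens(4) by metis
qed

lemma V_spanned: "x \<in> carrier V \<Longrightarrow> \<exists>z. x = hscalar q z \<odot>\<^bsub>V\<^esub> v"
proof -
  assume x: "x \<in> carrier V"
  have eq: "(complex_space q V)\<lparr>carrier := carrier V\<rparr> = complex_space q V"
    by (simp add: complex_space_def)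
  have "vectorspace complex_ring (complex_space q V)"
    "vectorspace.fin_dim complex_ring (complex_space q V)"
    "vectorspace.dim complex_ring (complex_space q V) = 1"
    using one_dim by (simp_all add: one_dim_module_def has_complex_dim_def Let_def eq)
  from vectorspace.dim_1_spanned[OF this, of v x] show ?thesis
    using x v by (auto simp: complex_space_def)
qed

lemma V_scalar_inject:
  assumes "hscalar q z \<odot>\<^bsub>V\<^esub> v = hscalar q w \<odot>\<^bsub>V\<^esub> v" shows "z = w"
proof (rule ccontr)
  assume "z \<noteq> w"
  have sv: "hscalar q z \<odot>\<^bsub>V\<^esub> v \<in> carrier V" for z using v parabolic_gens V_closed by simp
  have 0: "hscalar q a \<odot>\<^bsub>V\<^esub> \<zero>\<^bsub>V\<^esub> = \<zero>\<^bsub>V\<^esub>" for a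
  proof -
    have z: "hscalar q a \<odot>\<^bsub>V\<^esub> \<zero>\<^bsub>V\<^esub> \<in> carrier V"
      using parabolic_gens(4)[of q a i] by (intro V_closed) simp_all
    have "hscalar q a \<odot>\<^bsub>V\<^esub> \<zero>\<^bsub>V\<^esub> \<oplus>\<^bsub>V\<^esub> hscalar q a \<odot>\<^bsub>V\<^esub> \<zero>\<^bsub>V\<^esub> = hscalar q a \<odot>\<^bsub>V\<^esub> \<zero>\<^bsub>V\<^esub>"
      using V.smult_r_distr[of "hscalar q a" "\<zero>\<^bsub>V\<^esub>" "\<zero>\<^bsub>V\<^esub>"] by (simp add: parabolic_gens)
    then show ?thesis using z by simp
  qed
  have "hscalar q (z - w) \<odot>\<^bsub>V\<^esub> v \<oplus>\<^bsub>V\<^esub> hscalar q w \<odot>\<^bsub>V\<^esub> v = hscalar q w \<odot>\<^bsub>V\<^esub> v"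
    using V_scalars(1)[OF v(1), of "z - w" w] assms by simp
  then have "hscalar q (z - w) \<odot>\<^bsub>V\<^esub> v = \<zero>\<^bsub>V\<^esub>" using sv by simp
  then have "hscalar q (inverse (z - w)) \<odot>\<^bsub>V\<^esub> (hscalar q (z - w) \<odot>\<^bsub>V\<^esub> v) = \<zero>\<^bsub>V\<^esub>"
    by (simp add: 0)
  then have "v = \<zero>\<^bsub>V\<^esub>"
    using \<open>z \<noteq> w\<close> V_scalars(2,3)[OF v(1)] by (metis left_inverse right_minus_eq)
  then show False using v by simp
qed

text \<open>Equivariance is known on generators only, and the element \<open>s\<close> of the parabolic subalgebra is a class
  without a distinguished representative. Comparing eigenvalues makes the induction over the generated
  subring possible.\<close>

lemma eigenvalue:
  assumes "s \<in> S"
  shows "\<exists>z. s \<odot>\<^bsub>V\<^esub> v = hscalar q z \<odot>\<^bsub>V\<^esub> v \<and> act s base = z *s base"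
  using assms unfolding hecke_parabolic_def
proof (induction rule: generate_ring.induct)
  case one
  then show ?case using V_smult(3)[OF v(1)] V_scalars(3)[OF v(1)]
    by (intro exI[of _ 1]) (simp add: hecke_class_ops)
next
  case (incl h)
  have "\<exists>z. hecke_class q (group_alg_lift f) \<odot>\<^bsub>V\<^esub> v = hscalar q z \<odot>\<^bsub>V\<^esub> v \<and> torus_rep f base = z *s base" for f
  proof (induction f rule: poly_mapping_add_induct)
    case zero
    have "group_alg_lift 0 = free_scalar 0" by (simp add: group_alg_lift_def free_scalar_ops)
    then show ?case by (intro exI[of _ 0]) simp
  next
    case (single l z)
    have "hecke_class q (group_alg_lift (Poly_Mapping.single l z)) \<odot>\<^bsub>V\<^esub> v = hscalar q (z * t l) \<odot>\<^bsub>V\<^esub> v"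
      using V_smult(2)[OF v(1), of "hscalar q z" "hX q l"] V_scalars(2)[OF v(1), of z "t l"]
      by (simp add: group_alg_lift_single hecke_class_ops parabolic_gens v)
    then show ?case by (intro exI[of _ "z * t l"]) (simp add: Y_base)
  next
    case (add f g)
    then obtain z w where "hecke_class q (group_alg_lift f) \<odot>\<^bsub>V\<^esub> v = hscalar q z \<odot>\<^bsub>V\<^esub> v" "torus_rep f base = z *s base"
      "hecke_class q (group_alg_lift g) \<odot>\<^bsub>V\<^esub> v = hscalar q w \<odot>\<^bsub>V\<^esub> v" "torus_rep g base = w *s base"
      by blast
    then show ?case
      using V_smult(1)[OF v(1), OF parabolic_gens(2) parabolic_gens(2), of f g] V_scalars(1)[OF v(1), of z w]
      by (intro exI[of _ "z + w"])
        (simp add: group_alg_lift_add torus_rep_add hecke_class_ops scale_left_distrib)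
  qed
  then show ?case using incl v(3) T_base by (auto simp: rep_group_alg_lift)
next
  case (a_inv h)
  have h: "h \<in> S" using a_inv by (simp add: hecke_parabolic_def)
  then obtain f where f: "h = hecke_class q f" using S_carrier by blast
  from a_inv obtain z where z: "h \<odot>\<^bsub>V\<^esub> v = hscalar q z \<odot>\<^bsub>V\<^esub> v" "act h base = z *s base" by blast
  have "- f = free_scalar (- 1) * f" by (simp add: free_scalar_def single_uminus)
  then have "\<ominus>\<^bsub>hecke q\<^esub> h = hscalar q (- 1) \<otimes>\<^bsub>hecke q\<^esub> h"
    by (simp add: f hecke_a_inv hecke_class_ops)
  then have "(\<ominus>\<^bsub>hecke q\<^esub> h) \<odot>\<^bsub>V\<^esub> v = hscalar q (- 1 * z) \<odot>\<^bsub>V\<^esub> v"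
    using V_smult(2)[OF v(1) parabolic_gens(4) h, of "- 1"] V_scalars(2)[OF v(1), of "- 1" z] z by simp
  moreover have "act (\<ominus>\<^bsub>hecke q\<^esub> h) base = (- 1 * z) *s base"
    using z(2) rep_diff[of 0 f base] by (simp add: f hecke_a_inv)
  ultimately show ?case by blast
next
  case (eng_add h1 h2)
  have h: "h1 \<in> S" "h2 \<in> S" using eng_add by (simp_all add: hecke_parabolic_def)
  then obtain f1 f2 where f: "h1 = hecke_class q f1" "h2 = hecke_class q f2" using S_carrier by metis
  from eng_add obtain z w where z: "h1 \<odot>\<^bsub>V\<^esub> v = hscalar q z \<odot>\<^bsub>V\<^esub> v" "act h1 base = z *s base"
    "h2 \<odot>\<^bsub>V\<^esub> v = hscalar q w \<odot>\<^bsub>V\<^esub> v" "act h2 base = w *s base" by blast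
  have "act (h1 \<oplus>\<^bsub>hecke q\<^esub> h2) base = (z + w) *s base"
    using z f by (simp add: hecke_class_ops rep_add scale_left_distrib)
  then show ?case using V_smult(1)[OF v(1) h] z V_scalars(1)[OF v(1), of z w] by (intro exI[of _ "z + w"]) simp
next
  case (eng_mult h1 h2)
  have h: "h1 \<in> S" "h2 \<in> S" using eng_mult by (simp_all add: hecke_parabolic_def)
  then obtain f1 f2 where f: "h1 = hecke_class q f1" "h2 = hecke_class q f2" using S_carrier by metis
  from eng_mult obtain z w where z: "h1 \<odot>\<^bsub>V\<^esub> v = hscalar q z \<odot>\<^bsub>V\<^esub> v" "act h1 base = z *s base"
    "h2 \<odot>\<^bsub>V\<^esub> v = hscalar q w \<odot>\<^bsub>V\<^esub> v" "act h2 base = w *s base" by blast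
  have "act (h1 \<otimes>\<^bsub>hecke q\<^esub> h2) base = (w * z) *s base"
    using z f by (simp add: hecke_class_ops rep_mult rep_vscale)
  then show ?case using V_smult(2)[OF v(1) h] V_scalars(4)[OF v(1) h(1), of w] z V_scalars(2)[OF v(1), of w z]
    by (intro exI[of _ "w * z"]) simp
qed

definition coord :: "'v \<Rightarrow> complex" where
  "coord x = (THE z. x = hscalar q z \<odot>\<^bsub>V\<^esub> v)"

lemma coord_scalar: "coord (hscalar q z \<odot>\<^bsub>V\<^esub> v) = z"
  unfolding coord_def using V_scalar_inject by (intro the_equality) auto

lemma coord_add: "x \<in> carrier V \<Longrightarrow> y \<in> carrier V \<Longrightarrow> coord (x \<oplus>\<^bsub>V\<^esub> y) = coord x + coord y"
proof -
  assume "x \<in> carrier V" "y \<in> carrier V"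
  then obtain z w where *: "x = hscalar q z \<odot>\<^bsub>V\<^esub> v" "y = hscalar q w \<odot>\<^bsub>V\<^esub> v" using V_spanned by blast
  then have "x \<oplus>\<^bsub>V\<^esub> y = hscalar q (z + w) \<odot>\<^bsub>V\<^esub> v" using V_scalars(1)[OF v(1)] by simp
  then show ?thesis by (simp add: coord_scalar *)
qed

lemma coord_equivariant:
  assumes "s \<in> S" "x \<in> carrier V"
  shows "coord (s \<odot>\<^bsub>V\<^esub> x) *s base = act s (coord x *s base)"
proof -
  obtain w where w: "x = hscalar q w \<odot>\<^bsub>V\<^esub> v" using V_spanned assms by blast
  obtain z where z: "s \<odot>\<^bsub>V\<^esub> v = hscalar q z \<odot>\<^bsub>V\<^esub> v" "act s base = z *s base"
    using eigenvalue assms by blast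
  obtain f where f: "s = hecke_class q f" using S_carrier assms by blast
  have "s \<odot>\<^bsub>V\<^esub> x = hscalar q (w * z) \<odot>\<^bsub>V\<^esub> v"
    using V_scalars(4)[OF v(1) assms(1)] V_scalars(2)[OF v(1)] by (simp add: w z)
  then show ?thesis using z(2) by (simp add: coord_scalar w f rep_vscale)
qed

sublocale balanced_map "hecke q" S V scale "\<lambda>a x. act a (coord x *s base)"
proof
  fix a b x assume "a \<in> carrier (hecke q)" "b \<in> carrier (hecke q)"
  then show "act (a \<oplus>\<^bsub>hecke q\<^esub> b) (coord x *s base) = act a (coord x *s base) + act b (coord x *s base)"
    by (auto simp: carrier_hecke hecke_class_ops rep_add)
next
  fix a x y assume "a \<in> carrier (hecke q)" "x \<in> carrier V" "y \<in> carrier V"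
  then show "act a (coord (x \<oplus>\<^bsub>V\<^esub> y) *s base) = act a (coord x *s base) + act a (coord y *s base)"
    by (auto simp: carrier_hecke coord_add scale_left_distrib rep_vadd)
next
  fix a s x assume *: "a \<in> carrier (hecke q)" "s \<in> S" "x \<in> carrier V"
  then obtain f where "s = hecke_class q f" using S_carrier by blast
  then show "act (a \<otimes>\<^bsub>hecke q\<^esub> s) (coord x *s base) = act a (coord (s \<odot>\<^bsub>V\<^esub> x) *s base)"
    using * by (auto simp: carrier_hecke hecke_class_ops rep_mult coord_equivariant)
qed

lemma induced_map_zero: "induced_map \<zero>\<^bsub>ext\<^esub> = 0"
  using induced_map_add[of "\<zero>\<^bsub>ext\<^esub>" "\<zero>\<^bsub>ext\<^esub>"] by simp

lemma induced_map_app: "m \<in> carrier ext \<Longrightarrow> induced_map (M.app f m) = rep f (induced_map m)"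
proof -
  assume m: "m \<in> carrier ext"
  let ?H = "{m \<in> carrier ext. induced_map (M.app f m) = rep f (induced_map m)}"
  have neg: "induced_map (\<ominus>\<^bsub>ext\<^esub> x) = - induced_map x" if "x \<in> carrier ext" for x
    using induced_map_add[of "\<ominus>\<^bsub>ext\<^esub> x" x] that by (simp add: induced_map_zero M.M.l_neg eq_neg_iff_add_eq_0)
  have "m \<in> ?H"
  proof (rule ext_induct[OF m])
    show "\<zero>\<^bsub>ext\<^esub> \<in> ?H" by (simp add: induced_map_zero)
    show "x \<oplus>\<^bsub>ext\<^esub> y \<in> ?H" if "x \<in> ?H" "y \<in> ?H" for x y
      using that by (simp add: M.app_vadd induced_map_add rep_vadd)
    show "\<ominus>\<^bsub>ext\<^esub> x \<in> ?H" if "x \<in> ?H" for x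
    proof -
      have x: "x \<in> carrier ext" using that by simp
      have "M.app f (\<ominus>\<^bsub>ext\<^esub> x) = \<ominus>\<^bsub>ext\<^esub> M.app f x"
        using x by (simp add: M.app_minus_1 M.app_scalar_central)
      then show ?thesis using that x rep_vdiff[of f 0 "induced_map x"] by (simp add: neg)
    qed
    fix a x assume "a \<in> carrier (hecke q)" "x \<in> carrier V"
    then show "tensor a x \<in> ?H"
      by (auto simp: carrier_hecke tensor_closed smult_tensor induced_map_tensor hecke_class_ops rep_mult)
  qed
  then show ?thesis by simp
qed

definition gen_vec :: "(gen free_alg set \<times> 'v \<Rightarrow>\<^sub>0 int) set" where
  "gen_vec = tensor (hecke_class q 1) v"

lemma gen_vec_closed: "gen_vec \<in> carrier ext"
  by (simp add: gen_vec_def tensor_closed v)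

lemma tensor_scalar: "tensor (hecke_class q f) (hscalar q z \<odot>\<^bsub>V\<^esub> v) = M.app (f * free_scalar z) gen_vec"
  using tensor_balanced[of "hecke_class q f" "hscalar q z" v]
  by (simp add: gen_vec_def smult_tensor v parabolic_gens hecke_class_ops)

lemma app_gen_vec:
  "M.app (fT i) gen_vec = M.app (free_scalar c) gen_vec"
  "M.app (fX l) gen_vec = M.app (free_scalar (t l)) gen_vec"
proof -
  have "M.app f gen_vec = tensor (hecke_class q 1) (hecke_class q f \<odot>\<^bsub>V\<^esub> v)" if "hecke_class q f \<in> S" for f
    using that tensor_balanced[of "hecke_class q 1" "hecke_class q f" v]
    by (simp add: gen_vec_def smult_tensor v hecke_class_ops)
  then show "M.app (fT i) gen_vec = M.app (free_scalar c) gen_vec"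
    "M.app (fX l) gen_vec = M.app (free_scalar (t l)) gen_vec"
    using tensor_scalar[of 1] by (simp_all add: parabolic_gens v)
qed

lemma induced_map_gen_vec: "induced_map gen_vec = base"
  using coord_scalar[of 1] V_scalars(3)[OF v(1)] by (simp add: gen_vec_def induced_map_tensor v)

lemma induced_module_generated:
  assumes "W \<subseteq> carrier ext" "\<zero>\<^bsub>ext\<^esub> \<in> W" "\<And>x y. x \<in> W \<Longrightarrow> y \<in> W \<Longrightarrow> x \<oplus>\<^bsub>ext\<^esub> y \<in> W"
    and "\<And>f. M.app f gen_vec \<in> W" "\<And>z x. x \<in> W \<Longrightarrow> M.app (free_scalar z) x \<in> W"
    and m: "m \<in> carrier ext"
  shows "m \<in> W"
proof (rule ext_induct[OF m])
  show "\<zero>\<^bsub>ext\<^esub> \<in> W" by (rule assms(2))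
  show "x \<oplus>\<^bsub>ext\<^esub> y \<in> W" if "x \<in> W" "y \<in> W" for x y using that by (rule assms(3))
  show "\<ominus>\<^bsub>ext\<^esub> x \<in> W" if "x \<in> W" for x
    using assms(5)[OF that, of "- 1"] M.app_minus_1[of x] assms(1) that by auto
  fix a x assume "a \<in> carrier (hecke q)" "x \<in> carrier V"
  then obtain f z where "a = hecke_class q f" "x = hscalar q z \<odot>\<^bsub>V\<^esub> v"
    using V_spanned[of x] by (auto simp: carrier_hecke)
  then show "tensor a x \<in> W" using assms(4) by (simp only: tensor_scalar)
qed

lemma induced_map_comb:
  assumes "\<And>k. u k \<in> carrier ext"
  shows "induced_map (M.comb u d n) = (\<Sum>k<n. d k *s induced_map (u k))"
proof (induction n)
  case 0
  show ?case by (simp add: induced_map_zero)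
next
  case (Suc n)
  have "M.comb u d n \<in> carrier ext" by (rule M.comb_closed[OF assms])
  then show ?case using Suc.IH assms[of n]
    by (simp add: induced_map_add induced_map_app)
qed

end

section \<open>The five-dimensional submodule\<close>

fun coords6 :: "e6 \<Rightarrow> nat \<Rightarrow> complex" where
  "coords6 (a, b, c, d, e, f) k = (if k < 6 then [a, b, c, d, e, f] ! k else 0)"

lemma coords6_linear:
  "coords6 (u + v) k = coords6 u k + coords6 v k" "coords6 (scale6 z u) k = z * coords6 u k"
  by (cases u; cases v; auto simp: less_Suc_eq eval_nat_numeral)+

lemma bij_coords6: "bij_betw coords6 five {f. \<forall>i\<ge>5. f i = 0}"
proof (rule bij_betwI')
  fix u v assume "u \<in> five" "v \<in> five"
  then obtain a b c d e a' b' c' d' e' where uv: "u = (a, b, c, d, e, 0)" "v = (a', b', c', d', e', 0)" by auto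
  show "coords6 u = coords6 v \<longleftrightarrow> u = v"
  proof
    assume eq: "coords6 u = coords6 v"
    show "u = v"
      using fun_cong[OF eq, of 0] fun_cong[OF eq, of 1] fun_cong[OF eq, of 2] fun_cong[OF eq, of 3] fun_cong[OF eq, of 4]
      by (simp add: uv)
  qed simp
next
  fix u assume "u \<in> five"
  then obtain a b c d e where u: "u = (a, b, c, d, e, 0)" by auto
  have "k < 6 \<Longrightarrow> k \<ge> 5 \<Longrightarrow> k = 5" for k :: nat by simp
  then show "coords6 u \<in> {f. \<forall>i\<ge>5. f i = 0}" by (auto simp: u)
next
  fix f :: "nat \<Rightarrow> complex" assume "f \<in> {f. \<forall>i\<ge>5. f i = 0}"
  then have f: "f k = 0" if "k \<ge> 5" for k using that by simp
  have "f = coords6 (f 0, f 1, f 2, f 3, f 4, 0)"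
  proof
    fix k :: nat
    consider "k \<in> {0, 1, 2, 3, 4}" | "k \<ge> 5" by force
    then show "f k = coords6 (f 0, f 1, f 2, f 3, f 4, 0) k"
    proof cases
      case 2
      then have "k = 5 \<or> \<not> k < 6" by auto
      then show ?thesis using f[OF 2] by auto
    qed auto
  qed
  then show "\<exists>u\<in>five. f = coords6 u" by blast
qed

text \<open>The module of part (a). With \<open>-q\<^sup>-\<^sup>1\<close> in the role of \<open>q\<close> it is also that of part (b).\<close>

locale induced_trivial =
  fixes q :: complex and V :: "(gen free_alg set, 'v) module" and v :: 'v
  assumes q_nonzero: "q \<noteq> 0" and fifth: "fifth_root (q\<^sup>2)"
    and one_dim: "one_dim_module q N1 V v q (torus_point (q\<^sup>2) (q\<^sup>2))"
begin

sublocale fifth_root "q\<^sup>2" by (rule fifth)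

sublocale character_induction scale6 q "T6 q" "torus6 (q\<^sup>2)" N1 V v q "torus_point (q\<^sup>2) (q\<^sup>2)" base6
proof (intro character_induction.intro character_induction_axioms.intro hecke_rep_model q_nonzero fifth one_dim)
  show "T6 q N1 base6 = scale6 q base6"
    using q_nonzero by (simp add: T6_def base6_def power2_eq_square)
  show "torus6 (q\<^sup>2) l base6 = scale6 (torus_point (q\<^sup>2) (q\<^sup>2) l) base6" for l
    using q_nonzero by (cases l) (simp add: base6_def torus_point_def power_int_add)
qed

abbreviation \<theta> :: "node \<Rightarrow> gen free_alg" where "\<theta> i \<equiv> free_scalar q * fT i"

lemma rep_\<theta>: "rep (\<theta> i) u = tau (q\<^sup>2) i u"
  using q_nonzero by (simp add: rep_mult T6_def)

primrec basis :: "nat \<Rightarrow> (gen free_alg set \<times> 'v \<Rightarrow>\<^sub>0 int) set" where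
  "basis 0 = gen_vec"
| "basis (Suc k) = M.app (\<theta> (if even k then N2 else N1)) (basis k)"

lemma basis_closed: "basis k \<in> carrier ext"
  by (induction k) (simp_all add: gen_vec_closed)

lemma induced_map_basis: "induced_map (basis k) = model_basis k"
  by (induction k) (simp_all add: induced_map_gen_vec induced_map_app basis_closed rep_\<theta> del: tau.simps)

lemma app_T: "m \<in> carrier ext \<Longrightarrow> M.app (fT i) m = M.app (free_scalar (inverse q)) (M.app (\<theta> i) m)"
proof -
  assume m: "m \<in> carrier ext"
  have "fT i = free_scalar (inverse q) * \<theta> i"
    using q_nonzero by (simp flip: mult.assoc free_scalar_ops(2)) (simp add: free_scalar_ops)
  then show ?thesis using m by (metis M.app_mult)
qed

lemma \<theta>_quadratic:
  assumes "m \<in> carrier ext"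
  shows "M.app (\<theta> i) (M.app (\<theta> i) m)
    = M.app (free_scalar (q\<^sup>2 - 1)) (M.app (\<theta> i) m) \<oplus>\<^bsub>ext\<^esub> M.app (free_scalar (q\<^sup>2)) m"
proof -
  have q: "q * q * (q - inverse q) = (q\<^sup>2 - 1) * q"
    using q_nonzero by (simp add: field_simps power2_eq_square)
  have "M.app (\<theta> i) (M.app (\<theta> i) m) = M.app (free_scalar (q * q)) (M.app (fT i * fT i) m)"
    using assms by (simp add: M.app_mult M.app_scalar_central[where f = "fT _"] free_scalar_ops)
  also have "\<dots> = M.app (free_scalar (q * q * (q - inverse q))) (M.app (fT i) m) \<oplus>\<^bsub>ext\<^esub> M.app (free_scalar (q\<^sup>2)) m"
    unfolding hecke_relations(3) using assms
    by (simp add: M.app_add M.app_mult M.app_vadd M.app_1 free_scalar_ops power2_eq_square)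
  also have "\<dots> = M.app (free_scalar (q\<^sup>2 - 1)) (M.app (\<theta> i) m) \<oplus>\<^bsub>ext\<^esub> M.app (free_scalar (q\<^sup>2)) m"
    unfolding q free_scalar_ops(2) using assms by (simp add: M.app_mult)
  finally show ?thesis .
qed

lemma \<theta>_braid:
  assumes "m \<in> carrier ext"
  shows "M.app (\<theta> N1) (M.app (\<theta> N2) (M.app (\<theta> N1) (M.app (\<theta> N2) (M.app (\<theta> N1) (M.app (\<theta> N2) m)))))
    = M.app (\<theta> N2) (M.app (\<theta> N1) (M.app (\<theta> N2) (M.app (\<theta> N1) (M.app (\<theta> N2) (M.app (\<theta> N1) m)))))"
proof -
  let ?s = "\<lambda>m. M.app (free_scalar q) (M.app (free_scalar q) (M.app (free_scalar q)
    (M.app (free_scalar q) (M.app (free_scalar q) (M.app (free_scalar q) m)))))"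
  have "M.app (\<theta> i) (M.app (\<theta> j) (M.app (\<theta> i) (M.app (\<theta> j) (M.app (\<theta> i) (M.app (\<theta> j) m)))))
     = ?s (M.app (fT i * fT j * fT i * fT j * fT i * fT j) m)" for i j
    using assms by (simp add: M.app_mult M.app_scalar_central[where f = "fT _"])
  then show ?thesis by (simp only: hecke_relations(4))
qed

lemma \<theta>_gen_vec: "M.app (\<theta> N1) gen_vec = M.app (free_scalar (q\<^sup>2)) gen_vec"
  using app_gen_vec(1) by (simp add: M.app_mult gen_vec_closed free_scalar_ops power2_eq_square)

abbreviation W where "W \<equiv> M.combs basis 6"

lemmas W_closed = M.combs_closed[of basis, OF basis_closed]

text \<open>The operators \<open>\<tau>\<^sub>1, \<tau>\<^sub>2\<close> move along the chain of basis vectors alternately: upwards by definition, downwards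
  by the quadratic relation. At the lower end \<open>\<tau>\<^sub>1\<close> acts by \<open>x\<close>, and the braid relation carries this over
  to the upper end.\<close>

lemma \<theta>_basis:
  assumes "k < 6"
  shows "M.app (\<theta> i) (basis k) \<in> W"
proof -
  have up: "M.app (\<theta> i) (basis k) \<in> W" if "i = (if even k then N2 else N1)" "k < 5" for k i
    using W_closed(5)[of "Suc k" 6] that by simp
  have down: "M.app (\<theta> i) (basis (Suc k)) \<in> W" if "i = (if even k then N2 else N1)" "k < 5" for k i
  proof -
    have suc: "basis (Suc k) = M.app (\<theta> i) (basis k)" using that(1) by simp
    have "M.app (\<theta> i) (basis (Suc k))
        = M.app (free_scalar (q\<^sup>2 - 1)) (basis (Suc k)) \<oplus>\<^bsub>ext\<^esub> M.app (free_scalar (q\<^sup>2)) (basis k)"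
      unfolding suc by (rule \<theta>_quadratic[OF basis_closed])
    moreover have "basis (Suc k) \<in> W" "basis k \<in> W"
      using that(2) by (intro W_closed(5); simp)+
    ultimately show ?thesis by (simp only: W_closed(3,4))
  qed
  have "gen_vec \<in> W" using W_closed(5)[of 0 6] by simp
  then have bottom: "M.app (\<theta> N1) (basis 0) \<in> W"
    by (simp add: \<theta>_gen_vec W_closed(4))
  have "5 = Suc (Suc (Suc (Suc (Suc 0))))" by simp
  then have b5: "basis 5 = M.app (\<theta> N2) (M.app (\<theta> N1) (M.app (\<theta> N2) (M.app (\<theta> N1) (M.app (\<theta> N2) gen_vec))))"
    by (simp only: basis.simps) simp
  have "M.app (\<theta> N1) (basis 5) = M.app (free_scalar (q\<^sup>2)) (basis 5)"
    unfolding b5 \<theta>_braid[OF gen_vec_closed] \<theta>_gen_vec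
    by (simp add: gen_vec_closed M.app_scalar_central)
  then have top: "M.app (\<theta> N1) (basis 5) \<in> W"
    using W_closed(4,5) by simp
  show ?thesis
  proof (cases "i = (if even k then N2 else N1)")
    case True
    then show ?thesis using assms up[OF True] top by (cases "k = 5") simp_all
  next
    case False
    show ?thesis
    proof (cases k)
      case 0
      with False have "i = N1" by (cases i) simp_all
      then show ?thesis using bottom 0 by simp
    next
      case (Suc j)
      with False have "i = (if even j then N2 else N1)" by (cases i) (simp_all split: if_splits)
      then show ?thesis using down[of i j] assms Suc by simp
    qed
  qed
qed

lemma T_W:
  assumes "m \<in> W"
  shows "M.app (fT i) m \<in> W"
proof -
  have "M.app (\<theta> i) m \<in> W"
    by (rule M.app_combs[of basis, OF basis_closed _ assms]) (rule \<theta>_basis)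
  then have "M.app (free_scalar (inverse q)) (M.app (\<theta> i) m) \<in> W" by (rule W_closed(4))
  moreover have "m \<in> carrier ext" using W_closed(1) assms by (rule subsetD)
  ultimately show ?thesis by (simp only: app_T)
qed

lemma X_basis: "k < 6 \<Longrightarrow> M.app (fX l) (basis k) \<in> W"
proof (induction k arbitrary: l)
  case 0
  have "gen_vec \<in> W" using W_closed(5)[of 0 6] by simp
  then show ?case by (simp add: app_gen_vec W_closed(4))
next
  case (Suc k)
  define j where "j = (if even k then N2 else N1)"
  have "M.app (fX l) (M.app (fT j) (basis k)) \<in> W"
    by (rule M.torus_preserved[of W]) (use W_closed T_W Suc in simp_all)
  then have "M.app (free_scalar q) (M.app (fX l) (M.app (fT j) (basis k))) \<in> W" by (rule W_closed(4))
  then show ?case by (simp add: M.app_mult basis_closed M.app_scalar_central flip: j_def)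
qed

lemma spanned: "carrier ext = W"
proof
  show "W \<subseteq> carrier ext" by (rule W_closed)
  have generated: "M.app f gen_vec \<in> W" for f
  proof (rule M.combs_all[of basis, OF basis_closed])
    show "M.app (fT i) (basis k) \<in> W" if "k < 6" for k i
      using that by (intro T_W W_closed(5))
    show "gen_vec \<in> W" using W_closed(5)[of 0 6] by simp
  qed (rule X_basis)
  show "carrier ext \<subseteq> W"
    by (rule subsetI, rule induced_module_generated) (rule W_closed generated | assumption)+
qed

lemma induced_map_inj: "inj_on induced_map (carrier ext)"
proof -
  have kernel: "m = \<zero>\<^bsub>ext\<^esub>" if m: "m \<in> carrier ext" "induced_map m = 0" for m
  proof -
    obtain d where d: "m = M.comb basis d 6" using m(1) unfolding spanned M.combs_def by auto
    have "(\<Sum>k<6. scale6 (d k) (model_basis k)) = 0"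
      using m(2) induced_map_comb[of basis, OF basis_closed, of d 6] by (simp add: d induced_map_basis)
    then have d0: "d k = 0" if "k < 6" for k using model_basis_independent that by blast
    have "M.comb basis d n = \<zero>\<^bsub>ext\<^esub>" if "n \<le> 6" for n
      using that by (induction n) (simp_all add: d0 free_scalar_ops M.app_0 basis_closed)
    then show ?thesis by (simp add: d)
  qed
  show ?thesis
  proof (rule inj_onI)
    fix x y assume xy: "x \<in> carrier ext" "y \<in> carrier ext" "induced_map x = induced_map y"
    have "induced_map (x \<oplus>\<^bsub>ext\<^esub> M.app (free_scalar (- 1)) y) = 0"
      using xy by (simp add: induced_map_add induced_map_app)
    then have "x \<oplus>\<^bsub>ext\<^esub> M.app (free_scalar (- 1)) y = \<zero>\<^bsub>ext\<^esub>" using xy by (intro kernel) simp_all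
    then have "x \<oplus>\<^bsub>ext\<^esub> (\<ominus>\<^bsub>ext\<^esub> y) = \<zero>\<^bsub>ext\<^esub>" using xy by (simp add: M.app_minus_1)
    then show "x = y" using xy by (simp add: M.M.minus_eq[symmetric] M.M.r_right_minus_eq)
  qed
qed

definition sub where "sub = {m \<in> carrier ext. induced_map m \<in> five}"

lemma five_closed:
  assumes "u \<in> five"
  shows "u' \<in> five \<Longrightarrow> u + u' \<in> five" "scale6 z u \<in> five" "T6 q i u \<in> five"
    "torus6 (q\<^sup>2) l u \<in> five"
proof -
  obtain a b c d e f where "u = (a, b, c, d, e, f)" by (metis prod_cases6)
  with assms have u: "u = (a, b, c, d, e, 0)" by simp
  show "u' \<in> five \<Longrightarrow> u + u' \<in> five" by (cases u') (simp add: u)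
  show "scale6 z u \<in> five" by (simp add: u)
  show "T6 q i u \<in> five" by (cases i) (simp_all add: u T6_def)
  show "torus6 (q\<^sup>2) l u \<in> five" by (cases l) (simp add: u)
qed

lemma submodule_sub: "Module.submodule sub (hecke q) ext"
proof (rule M.submoduleI)
  have zero: "0 \<in> five" by (simp add: zero_prod_def)
  show "sub \<subseteq> carrier ext" by (simp add: sub_def)
  show "\<zero>\<^bsub>ext\<^esub> \<in> sub" using zero by (simp only: sub_def mem_Collect_eq induced_map_zero M.M.zero_closed)
  show "m \<oplus>\<^bsub>ext\<^esub> m' \<in> sub" if "m \<in> sub" "m' \<in> sub" for m m'
    using that five_closed(1)[of "induced_map m" "induced_map m'"]
    by (simp only: sub_def mem_Collect_eq induced_map_add M.M.a_closed)
  show "M.app f m \<in> sub" if "m \<in> sub" for f m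
  proof -
    have m: "m \<in> carrier ext" "induced_map m \<in> five" using that by (simp_all only: sub_def mem_Collect_eq)
    have "rep f (induced_map m) \<in> five"
      by (rule rep_closed) (rule zero five_closed m | assumption)+
    then show ?thesis using m(1) by (simp only: sub_def mem_Collect_eq induced_map_app M.app_closed)
  qed
qed

lemma submodule_image:
  assumes N: "Module.submodule N (hecke q) ext" "N \<subseteq> sub" "N \<noteq> {\<zero>\<^bsub>ext\<^esub>}"
  shows "induced_map ` N = five"
proof -
  note closed = M.submodule_closed[OF N(1)]
  obtain m where m: "m \<in> N" "m \<noteq> \<zero>\<^bsub>ext\<^esub>" using N(3) closed(2) by blast
  then have mc: "m \<in> carrier ext" using closed(1) by (meson subsetD)
  have "induced_map m \<noteq> 0"
  proof
    assume "induced_map m = 0"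
    then have "induced_map m = induced_map \<zero>\<^bsub>ext\<^esub>" by (simp only: induced_map_zero)
    then have "m = \<zero>\<^bsub>ext\<^esub>" by (rule inj_onD[OF induced_map_inj _ mc M.M.zero_closed])
    with m(2) show False by contradiction
  qed
  moreover have app: "rep f u \<in> induced_map ` N" if u: "u \<in> induced_map ` N" for f u
  proof -
    obtain n where n: "n \<in> N" "u = induced_map n" using u by (rule imageE)
    then have "n \<in> carrier ext" using closed(1) by (meson subsetD)
    then have "rep f u = induced_map (M.app f n)" by (simp only: n(2) induced_map_app)
    then show ?thesis using closed(4)[OF n(1)] by (simp only: imageI)
  qed
  ultimately show ?thesis
  proof (intro five_irreducible)
    show "induced_map ` N \<subseteq> five" using N(2) by (auto simp: sub_def)
    show "induced_map m \<in> induced_map ` N" using m by simp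
    fix u assume u: "u \<in> induced_map ` N"
    show "scale6 z u \<in> induced_map ` N" for z using app[OF u, of "free_scalar z"] by simp
    show "tau (q\<^sup>2) i u \<in> induced_map ` N" for i using app[OF u, of "\<theta> i"] by (simp only: rep_\<theta>)
    show "torus6 (q\<^sup>2) l u \<in> induced_map ` N" for l using app[OF u, of "fX l"] by simp
    show "u + u' \<in> induced_map ` N" if u': "u' \<in> induced_map ` N" for u'
    proof -
      obtain n n' where "n \<in> N" "u = induced_map n" "n' \<in> N" "u' = induced_map n'" using u u' by blast
      moreover from this have "n \<in> carrier ext" "n' \<in> carrier ext" using closed(1) by (meson subsetD)+
      ultimately have "u + u' = induced_map (n \<oplus>\<^bsub>ext\<^esub> n')" by (simp only: induced_map_add)
      then show ?thesis using closed(3)[OF \<open>n \<in> N\<close> \<open>n' \<in> N\<close>] by (simp only: imageI)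
    qed
  qed
qed

lemma sub_nonzero: "sub \<noteq> {\<zero>\<^bsub>ext\<^esub>}"
proof
  assume zero: "sub = {\<zero>\<^bsub>ext\<^esub>}"
  let ?m = "basis 1 \<oplus>\<^bsub>ext\<^esub> M.app (free_scalar (- (q\<^sup>2))) (basis 0)"
  have "induced_map ?m = model_basis 1 + scale6 (- (q\<^sup>2)) (model_basis 0)"
    using basis_closed[of 0] basis_closed[of 1]
    by (simp only: induced_map_add induced_map_app M.app_closed induced_map_basis rep_gens)
  then have *: "induced_map ?m = (0, - (q\<^sup>2 + (q\<^sup>2)^2), 0, 0, 0, 0)"
    unfolding model_basis_values by simp
  moreover have "?m \<in> carrier ext" by (intro M.M.a_closed M.app_closed basis_closed)
  ultimately have "?m \<in> sub" by (simp only: sub_def mem_Collect_eq case_prod_conv simp_thms)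
  then have "induced_map ?m = 0" using zero induced_map_zero by simp
  then have "- (q\<^sup>2 + (q\<^sup>2)^2) = 0" unfolding * zero_prod_def by (simp only: prod.inject)
  then show False using x_neq(2) by (simp only: neg_equal_0_iff_equal)
qed

lemma irreducible_sub: "irreducible_submodule sub (hecke q) ext"
  unfolding irreducible_submodule_def
proof (intro conjI allI impI submodule_sub sub_nonzero)
  fix N assume N: "Module.submodule N (hecke q) ext \<and> N \<subseteq> sub"
  show "N = {\<zero>\<^bsub>ext\<^esub>} \<or> N = sub"
  proof (cases "N = {\<zero>\<^bsub>ext\<^esub>}")
    case False
    with N have "induced_map ` N = induced_map ` sub"
      using submodule_image[of N] submodule_image[OF submodule_sub] sub_nonzero by simp
    moreover have "inj_on induced_map sub"
      using induced_map_inj by (rule inj_on_subset) (simp add: sub_def)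
    ultimately show ?thesis using N by (metis inj_on_image_eq_iff order_refl)
  qed simp
qed

lemma dim_sub: "has_complex_dim q ext sub 5"
proof -
  let ?V = "(complex_space q ext)\<lparr>carrier := sub\<rparr>"
  have vs: "vectorspace complex_ring ?V" by (rule M.vectorspace_submodule[OF submodule_sub])
  have "bij_betw induced_map sub five"
    using submodule_image[OF submodule_sub order_refl sub_nonzero] induced_map_inj
    by (auto simp: bij_betw_def sub_def intro: inj_on_subset)
  then have "bij_betw (coords6 \<circ> induced_map) sub {f. \<forall>i\<ge>5. f i = 0}"
    using bij_coords6 by (rule bij_betw_trans)
  then have "vectorspace.fin_dim complex_ring ?V \<and> vectorspace.dim complex_ring ?V = 5"
    by (intro dim_by_coordinates[OF vs, of "coords6 \<circ> induced_map"])
      (auto simp: complex_space_def sub_def induced_map_add induced_map_app coords6_linear simp del: coords6.simps)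
  then show ?thesis using vs by (simp add: has_complex_dim_def Let_def)
qed

end

lemma fifth_root_of_primitive:
  assumes "primitive_root_of_unity 5 z"
  shows "fifth_root z"
proof
  have z: "z ^ 5 = 1" "z \<noteq> 1"
    using assms spec[of "\<lambda>k. 0 < k \<and> k < 5 \<longrightarrow> z ^ k \<noteq> 1" 1] by (auto simp: primitive_root_of_unity_def)
  have "(z - 1) * (1 + z + z^2 + z^3 + z^4) = z^5 - 1"
    by (simp add: eval_nat_numeral algebra_simps)
  then show "1 + z + z^2 + z^3 + z^4 = 0" using z by simp
qed

text \<open>The relators, and with them all derived notions, depend on \<open>q - q\<^sup>-\<^sup>1\<close> only.\<close>

lemma hecke_eq:
  assumes "q' - inverse q' = q - inverse q"
  shows "hecke q' = hecke q" "hecke_class q' = hecke_class q" "hecke_parabolic q' = hecke_parabolic q"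
proof -
  have i: "hecke_ideal q' = hecke_ideal q"
    unfolding hecke_ideal_def hecke_relators_def assms by (rule refl)
  then show h: "hecke q' = hecke q" and c: "hecke_class q' = hecke_class q"
    by (simp_all add: hecke_def hecke_class_def fun_eq_iff)
  show "hecke_parabolic q' = hecke_parabolic q"
    by (simp add: hecke_parabolic_def fun_eq_iff h c)
qed

theorem proposition31:
  fixes q :: complex
    and t :: "wlat \<Rightarrow> complex"
    and Vt :: "(gen free_alg set, 'v) module" and vt :: 'v
    and Vw0t :: "(gen free_alg set, 'w) module" and vw0t :: 'w
    and M :: "(gen free_alg set, (gen free_alg set \<times> 'v \<Rightarrow>\<^sub>0 int) set) module"
    and N :: "(gen free_alg set, (gen free_alg set \<times> 'w \<Rightarrow>\<^sub>0 int) set) module"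
  assumes "q \<noteq> 0"
    and "t = torus_point (q\<^sup>2) (q\<^sup>2)"
    and "one_dim_module q N1 Vt vt q t"
    and "one_dim_module q N1 Vw0t vw0t (- inverse q) (weyl_act w0 t)"
    and "M = induced_module (hecke q) (hecke_parabolic q N1) Vt"
    and "N = induced_module (hecke q) (hecke_parabolic q N1) Vw0t"
    and "primitive_root_of_unity 5 (q\<^sup>2)"
  shows "(\<exists>M'. irreducible_submodule M' (hecke q) M \<and> has_complex_dim q M M' 5) \<and>
         (\<exists>N'. irreducible_submodule N' (hecke q) N \<and> has_complex_dim q N N' 5)"
proof
  have fifth: "fifth_root (q\<^sup>2)" using assms(7) by (rule fifth_root_of_primitive)
  interpret M: induced_trivial q Vt vt
    by (intro induced_trivial.intro fifth assms(1) assms(3)[unfolded assms(2)])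
  show "\<exists>M'. irreducible_submodule M' (hecke q) M \<and> has_complex_dim q M M' 5"
    using M.irreducible_sub M.dim_sub unfolding assms(5) by blast
next
  define q' where "q' = - inverse q"
  have q': "q' \<noteq> 0" "q' - inverse q' = q - inverse q" "q'\<^sup>2 = inverse (q\<^sup>2)"
    using assms(1) by (simp_all add: q'_def power_inverse)
  note eq = hecke_eq[OF q'(2)]
  have class_eq: "hecke_class q' f = hecke_class q f" for f by (simp add: eq)
  have "primitive_root_of_unity 5 (q'\<^sup>2)"
    using assms(7) by (simp add: primitive_root_of_unity_def q'(3) power_inverse)
  then have fifth: "fifth_root (q'\<^sup>2)" by (rule fifth_root_of_primitive)
  have dim_eq: "has_complex_dim q' = (has_complex_dim q :: (gen free_alg set, 'x, 'y) module_scheme \<Rightarrow> _)"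
    by (simp add: fun_eq_iff has_complex_dim_def complex_space_def eq)
  have "one_dim_module q' N1 Vw0t vw0t q' (torus_point (q'\<^sup>2) (q'\<^sup>2))"
    using assms(4)[folded q'_def] unfolding assms(2) weyl_act_w0 one_dim_module_def eq dim_eq q'(3) .
  then interpret N: induced_trivial q' Vw0t vw0t
    by (intro induced_trivial.intro q'(1) fifth)
  show "\<exists>N'. irreducible_submodule N' (hecke q) N \<and> has_complex_dim q N N' 5"
    using N.irreducible_sub N.dim_sub unfolding assms(6) eq dim_eq by blast
qed

end
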